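(* Let $n$ be a positive integer and let $\kappa,\lambda,\mu,\nu$ be partitions of length at most $n$ such that $\mu\supseteq\nu$ and $m(\mu-\nu)\supseteq\lambda-\kappa$ for some positive integer $m$. Then, for all sufficiently large integers $r$, the sequence of skew Schur polynomials $\{s_{(\kappa+k\mu)/(\lambda+k\nu)}(x_1,\dots,x_n)\}_{k=r}^{\infty}$ satisfies a linear recurrence with coefficients polynomial in $x_1,\dots,x_n$, and a characteristic polynomial for the recurrence is given by $$\chi(t)=\prod_{T\in\mathbf{T}^n_{\mu/\nu}}\bigl(t-\mathbf{x}^{w(T)}\bigr),$$ where $\mathbf{T}^n_{\mu/\nu}$ is the set of semi-standard Young tableaux of shape $\mu/\nu$ with entries in $\{1,\dots,n\}$ and $w(T)$ is the weight of $T$. In particular, if $\lambda=\kappa=\emptyset$, one may take $r=0$.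
   Context: A partition is a finite weakly decreasing sequence $\lambda=(\lambda_1,\lambda_2,\dots)$ of non-negative integers; its length is the number of positive entries, and $\lambda_i=0$ for $i$ larger than the length. $\emptyset$ is the partition with no positive parts. Addition, subtraction and multiplication by scalars are elementwise. For integer vectors (in particular partitions) $\alpha\supseteq\beta$ means $\alpha_i\ge\beta_i$ for all $i$. For partitions $\lambda\supseteq\mu$, the skew Young diagram of shape $\lambda/\mu$ is the set of boxes $\{(i,j)\in\mathbb{Z}^2 : \mu_i<j\le\lambda_i\}$ ($i$ is the row, $j$ the column, both $\geq 1$). A semi-standard Young tableau (SSYT) of shape $\lambda/\mu$ with entries in $\{1,\dots,n\}$ is a filling of these boxes with elements of $\{1,\dots,n\}$ that is weakly increasing along rows (left to right) and strictly increasing down columns. The set of these is $\mathbf{T}^n_{\lambda/\mu}$. The weight of $T$ is $w(T)=(t_1,\dots,t_n)$, where $t_k$ is the number of boxes of $T$ containing $k$. For $\mathbf{x}=(x_1,\dots,x_n)$ and $\alpha\in\mathbb{N}^n$, $\mathbf{x}^{\alpha}=x_1^{\alpha_1}\cdots x_n^{\alpha_n}$. The skew Schur polynomial is $s_{\lambda/\mu}(\mathbf{x})=\sum_{T\in\mathbf{T}^n_{\lambda/\mu}}\mathbf{x}^{w(T)}$. A sequence $\{a_k\}_{k=r}^\infty$ satisfies a linear recurrence with characteristic polynomial $\chi(t)=\sum_{i=0}^d c_it^i$ (monic of degree $d$) if $\sum_{i=0}^d c_i a_{k+i}=0$ for all $k\ge r$. *)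

theory Defs
  imports
    "HOL-Library.Poly_Mapping"
    "HOL-Library.FuncSet"
    "HOL-Computational_Algebra.Polynomial"
begin

text \<open>
  A partition is an infinite sequence, padded with zeros. Its parts, and hence the rows of a
  diagram, are indexed from 0, so \<open>p i\<close> is the part usually written \<open>p\<close> with subscript \<open>i + 1\<close>.
  Columns of diagrams, tableau entries and polynomial variables are numbered from 1.
  Containment of partitions is the pointwise order on functions.
\<close>

definition is_partition :: "(nat \<Rightarrow> nat) \<Rightarrow> bool" where
  "is_partition p \<longleftrightarrow> antimono p \<and> finite {i. p i > 0}"

definition partition_length :: "(nat \<Rightarrow> nat) \<Rightarrow> nat" where
  "partition_length p = card {i. p i > 0}"

definition empty_partition :: "nat \<Rightarrow> nat" where
  "empty_partition = (\<lambda>i. 0)"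

definition skew_diagram :: "(nat \<Rightarrow> nat) \<Rightarrow> (nat \<Rightarrow> nat) \<Rightarrow> (nat \<times> nat) set" where
  "skew_diagram p q = {(i, j). q i < j \<and> j \<le> p i}"

text \<open>
  Using extensional functions makes two tableaux equal exactly when they agree on all boxes.
\<close>

definition ssyt :: "nat \<Rightarrow> (nat \<Rightarrow> nat) \<Rightarrow> (nat \<Rightarrow> nat) \<Rightarrow> (nat \<times> nat \<Rightarrow> nat) set" where
  "ssyt n p q = {T \<in> skew_diagram p q \<rightarrow>\<^sub>E {1..n}.
     (\<forall>i j j'. (i, j) \<in> skew_diagram p q \<and> (i, j') \<in> skew_diagram p q \<and> j < j'
        \<longrightarrow> T (i, j) \<le> T (i, j')) \<and>
     (\<forall>i i' j. (i, j) \<in> skew_diagram p q \<and> (i', j) \<in> skew_diagram p q \<and> i < i'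
        \<longrightarrow> T (i, j) < T (i', j))}"

definition weight ::
    "(nat \<Rightarrow> nat) \<Rightarrow> (nat \<Rightarrow> nat) \<Rightarrow> (nat \<times> nat \<Rightarrow> nat) \<Rightarrow> nat \<Rightarrow> nat" where
  "weight p q T k = card {b \<in> skew_diagram p q. T b = k}"

text \<open>
  Integer polynomials in countably many variables, as finitely supported maps from exponent
  vectors to coefficients; multiplication is convolution. Those in the first \<open>n\<close> variables are
  singled out by \<open>vars_of\<close>.
\<close>

type_synonym int_mpoly = "(nat \<Rightarrow>\<^sub>0 nat) \<Rightarrow>\<^sub>0 int"

definition var :: "nat \<Rightarrow> int_mpoly" where
  "var k = Poly_Mapping.single (Poly_Mapping.single k 1) 1"

definition vars_of :: "int_mpoly \<Rightarrow> nat set" where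
  "vars_of f = (\<Union>e \<in> Poly_Mapping.keys f. Poly_Mapping.keys e)"

definition x_power :: "nat \<Rightarrow> (nat \<Rightarrow> nat) \<Rightarrow> int_mpoly" where
  "x_power n a = (\<Prod>k = 1..n. var k ^ a k)"

definition skew_schur :: "nat \<Rightarrow> (nat \<Rightarrow> nat) \<Rightarrow> (nat \<Rightarrow> nat) \<Rightarrow> int_mpoly" where
  "skew_schur n p q = (\<Sum>T \<in> ssyt n p q. x_power n (weight p q T))"

definition satisfies_linear_recurrence ::
    "nat \<Rightarrow> (nat \<Rightarrow> 'a::comm_ring_1) \<Rightarrow> 'a poly \<Rightarrow> bool" where
  "satisfies_linear_recurrence r a \<chi> \<longleftrightarrow>
     lead_coeff \<chi> = 1 \<and> (\<forall>k\<ge>r. (\<Sum>i = 0..degree \<chi>. coeff \<chi> i * a (k + i)) = 0)"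

end

theory Submission
  imports Defs "HOL-Library.Function_Algebras" "HOL-Library.Multiset_Order"
begin

text \<open>
  A tableau is recorded by its Gelfand-Tsetlin pattern, the sequence of shapes formed by the entries
  at most \<open>k\<close>. Patterns of stretched shapes can be added, and adding a pattern of shape \<open>\<mu>\<close> over \<open>\<nu>\<close>
  multiplies the monomial by that of the pattern added. So the patterns of all the shapes in the
  sequence form a graded family on which the set \<open>L\<close> of patterns of shape \<open>\<mu>\<close> over \<open>\<nu>\<close> acts by
  addition, raising the degree \<open>k\<close> by one. The recurrence is an instance of the rationality of Hilbert
  series of finitely generated graded modules, with one factor of the denominator for each element
  of \<open>L\<close>, and it is obtained by cancelling patterns directly.

  Expanding the characteristic polynomial turns the recurrence into the vanishing of a signed sum
  over subsets \<open>S\<close> of \<open>L\<close> (\<open>satisfies_linear_recurrence_prod_iff\<close>). If the terms of the sequence are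
  sums over multisets \<open>m\<close> of elements of \<open>L\<close>, the sum runs over pairs of \<open>S\<close> and \<open>m\<close>, and moving an
  element between \<open>S\<close> and \<open>m\<close> cancels pairs (\<open>toggle_sum_zero\<close>). The move is possible for any element of
  high multiplicity, provided that membership of \<open>m\<close> does not depend on whether such an element
  occurs once more or less. Large multisets have such elements
  (\<open>stable_multisets_recurrence\<close>).

  For general \<open>\<kappa>\<close> and \<open>lam\<close>, the family is generated by a single degree: when \<open>k\<close> is large, a monotone
  function of Lipschitz constant 1 applied to all entries splits an element of \<open>L\<close> off any pattern
  (\<open>gt_pattern_split_step\<close>). Choosing the least representation by a generator and a multiset makes
  the multisets that occur with a given generator a down-closed family, and Dickson's lemma gives
  the required independence (\<open>downclosed_stable\<close>, \<open>finitely_generated_recurrence\<close>).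

  For empty \<open>\<kappa>\<close> and \<open>lam\<close>, a more precise normal form is available: every pattern is uniquely the sum
  of a chain of elements of \<open>L\<close> at pointwise distance at most 1, obtained by rounding
  (\<open>close_decomposition\<close>, \<open>close_eqI\<close>). Elements of multiplicity 2 can already be moved, and the only
  pairs left, at \<open>k = 0\<close>, contribute the reduced Euler characteristic of the complex of such chains.
  It is zero because the chains can be paired by toggling the least member increased by 1 and cut
  off at the greatest element of \<open>L\<close> (\<open>close_multisets_recurrence\<close>).
\<close>

section \<open>The characteristic polynomial as an alternating sum\<close>

text \<open>
  Each factor \<open>t - z i\<close> acts on sequences as "shift, minus \<open>z i\<close> times". Choosing the second
  summand exactly for \<open>i \<in> S\<close> gives the term of \<open>S\<close>. This turns a recurrence into a statement about
  signed sums over subsets, which is where combinatorial cancellation can act. The bound \<open>N\<close> is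
  free so that the induction need not follow the degree.
\<close>

lemma sum_coeff_prod_linear:
  fixes z :: "'i \<Rightarrow> 'a::comm_ring_1" and a :: "nat \<Rightarrow> 'a"
  assumes "finite I" "card I \<le> N"
  shows "(\<Sum>i\<le>N. coeff (\<Prod>i\<in>I. [:- z i, 1:]) i * a (k + i)) =
    (\<Sum>S\<in>Pow I. (-1) ^ card S * prod z S * a (k + card I - card S))"
  using assms
proof (induction I arbitrary: k N rule: finite_induct)
  case empty
  have "(\<Sum>i\<le>N. coeff 1 i * a (k + i)) = (\<Sum>i\<in>{0}. coeff 1 i * a (k + i))"
    by (rule sum.mono_neutral_right) auto
  then show ?case by simp
next
  case (insert x I)
  let ?p = "\<Prod>i\<in>I. [:- z i, 1:]"
  obtain M where M: "N = Suc M" "card I \<le> M"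
    using insert by (cases N) auto
  have "(\<Sum>i\<le>N. coeff (\<Prod>i\<in>insert x I. [:- z i, 1:]) i * a (k + i)) =
      (\<Sum>i\<le>N. - z x * (coeff ?p i * a (k + i)) + coeff (pCons 0 ?p) i * a (k + i))"
    using insert by (intro sum.cong) (auto simp: algebra_simps)
  also have "\<dots> = - z x * (\<Sum>i\<le>N. coeff ?p i * a (k + i)) + (\<Sum>i\<le>N. coeff (pCons 0 ?p) i * a (k + i))"
    by (simp only: sum.distrib sum_distrib_left)
  also have "(\<Sum>i\<le>N. coeff (pCons 0 ?p) i * a (k + i)) = (\<Sum>i\<le>M. coeff ?p i * a (Suc k + i))"
    unfolding M by (subst sum.atMost_Suc_shift) simp
  also have "\<dots> = (\<Sum>S\<in>Pow I. (-1) ^ card S * prod z S * a (Suc k + card I - card S))"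
    by (rule insert.IH) (use M in auto)
  also have "(\<Sum>i\<le>N. coeff ?p i * a (k + i)) =
      (\<Sum>S\<in>Pow I. (-1) ^ card S * prod z S * a (k + card I - card S))"
    by (rule insert.IH) (use M in auto)
  also have "- z x * (\<Sum>S\<in>Pow I. (-1) ^ card S * prod z S * a (k + card I - card S)) =
      (\<Sum>S\<in>insert x ` Pow I. (-1) ^ card S * prod z S * a (k + card (insert x I) - card S))"
  proof -
    have inj: "inj_on (insert x) (Pow I)"
      using insert.hyps by (auto simp: inj_on_def)
    have "(\<Sum>S\<in>insert x ` Pow I. (-1) ^ card S * prod z S * a (k + card (insert x I) - card S))
      = (\<Sum>S\<in>Pow I. (-1) ^ card (insert x S) * prod z (insert x S) * a (k + card (insert x I) - card (insert x S)))"
      by (simp add: sum.reindex[OF inj])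
    also have "\<dots> = (\<Sum>S\<in>Pow I. - z x * ((-1) ^ card S * prod z S * a (k + card I - card S)))"
    proof (rule sum.cong[OF refl])
      fix S assume "S \<in> Pow I"
      then have "finite S" "x \<notin> S"
        using insert.hyps by (auto intro: finite_subset)
      then show "(-1) ^ card (insert x S) * prod z (insert x S) * a (k + card (insert x I) - card (insert x S))
         = - z x * ((-1) ^ card S * prod z S * a (k + card I - card S))"
        using insert.hyps by (simp add: algebra_simps)
    qed
    finally show ?thesis by (simp add: sum_distrib_left)
  qed
  also have "(\<Sum>S\<in>insert x ` Pow I. (-1) ^ card S * prod z S * a (k + card (insert x I) - card S)) +
     (\<Sum>S\<in>Pow I. (-1) ^ card S * prod z S * a (Suc k + card I - card S)) =
     (\<Sum>S\<in>Pow (insert x I). (-1) ^ card S * prod z S * a (k + card (insert x I) - card S))"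
    unfolding Pow_insert using insert.hyps
    by (subst sum.union_disjoint) (auto simp: add.commute)
  finally show ?case .
qed

lemma degree_prod_linear_le:
  fixes z :: "'i \<Rightarrow> 'a::comm_ring_1"
  shows "degree (\<Prod>i\<in>I. [:- z i, 1:]) \<le> card I"
proof (cases "finite I")
  case True
  have "degree (\<Prod>i\<in>I. [:- z i, 1:]) \<le> (\<Sum>i\<in>I. degree [:- z i, 1:])"
    using degree_prod_sum_le[OF True, of "\<lambda>i. [:- z i, 1:]"] by (simp add: comp_def)
  then show ?thesis by simp
qed simp

lemma satisfies_linear_recurrence_prod_iff:
  fixes z :: "'i \<Rightarrow> 'a::idom"
  assumes "finite I"
  shows "satisfies_linear_recurrence r a (\<Prod>i\<in>I. [:- z i, 1:]) \<longleftrightarrow>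
    (\<forall>k\<ge>r. (\<Sum>S\<in>Pow I. (-1) ^ card S * prod z S * a (k + card I - card S)) = 0)"
proof -
  let ?p = "\<Prod>i\<in>I. [:- z i, 1:]"
  have "(\<Sum>i = 0..degree ?p. coeff ?p i * a (k + i)) =
      (\<Sum>S\<in>Pow I. (-1) ^ card S * prod z S * a (k + card I - card S))" for k
  proof -
    have "(\<Sum>i = 0..degree ?p. coeff ?p i * a (k + i)) = (\<Sum>i\<le>card I. coeff ?p i * a (k + i))"
      using degree_prod_linear_le[of z I]
      by (intro sum.mono_neutral_left) (auto simp: coeff_eq_0)
    then show ?thesis using sum_coeff_prod_linear[OF assms order_refl, of z a k] by simp
  qed
  then show ?thesis
    unfolding satisfies_linear_recurrence_def by (simp add: lead_coeff_prod)
qed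

section \<open>Cancelling pairs of a set and a multiset\<close>

text \<open>
  The sign-reversing involution behind all cancellations below: \<open>\<iota>\<close> picks an element, which is moved
  from \<open>S\<close> to \<open>m\<close> or back. The move changes the parity of \<open>card S\<close> and keeps the product of all \<open>z\<close>,
  and since it does not change the element picked, doing it twice is the identity.
\<close>

lemma toggle_sum_zero:
  fixes z :: "'i \<Rightarrow> 'a::comm_ring_1" and \<iota> :: "'i set \<Rightarrow> 'i multiset \<Rightarrow> 'i"
  assumes fin: "finite X" "\<And>S m. (S, m) \<in> X \<Longrightarrow> finite S"
    and out: "\<And>S m. (S, m) \<in> X \<Longrightarrow> \<iota> S m \<in> S \<Longrightarrow>
      (S - {\<iota> S m}, add_mset (\<iota> S m) m) \<in> X \<and> \<iota> (S - {\<iota> S m}) (add_mset (\<iota> S m) m) = \<iota> S m"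
    and into: "\<And>S m. (S, m) \<in> X \<Longrightarrow> \<iota> S m \<notin> S \<Longrightarrow> \<iota> S m \<in># m \<and>
      (insert (\<iota> S m) S, m - {#\<iota> S m#}) \<in> X \<and> \<iota> (insert (\<iota> S m) S) (m - {#\<iota> S m#}) = \<iota> S m"
  shows "(\<Sum>(S, m)\<in>X. (-1) ^ card S * prod z S * prod_mset (image_mset z m)) = 0"
proof -
  let ?f = "\<lambda>(S, m). (-1) ^ card S * prod z S * prod_mset (image_mset z m)"
  let ?X1 = "{(S, m)\<in>X. \<iota> S m \<in> S}" and ?X0 = "{(S, m)\<in>X. \<iota> S m \<notin> S}"
  have "sum ?f ?X1 = sum (\<lambda>x. - ?f x) ?X0"
  proof (rule sum.reindex_bij_witness[where
        j = "\<lambda>(S, m). (S - {\<iota> S m}, add_mset (\<iota> S m) m)" and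
        i = "\<lambda>(S, m). (insert (\<iota> S m) S, m - {#\<iota> S m#})"])
    fix x assume "x \<in> ?X1"
    then obtain S m where x: "x = (S, m)" "(S, m) \<in> X" "\<iota> S m \<in> S" by auto
    note o = out[OF x(2,3)] and f = fin(2)[OF x(2)]
    show "(case case x of (S, m) \<Rightarrow> (S - {\<iota> S m}, add_mset (\<iota> S m) m) of
        (S, m) \<Rightarrow> (insert (\<iota> S m) S, m - {#\<iota> S m#})) = x"
      using o x(3) unfolding x(1) by (simp add: insert_absorb)
    show "(case x of (S, m) \<Rightarrow> (S - {\<iota> S m}, add_mset (\<iota> S m) m)) \<in> ?X0"
      using o unfolding x(1) by simp
    show "- (case case x of (S, m) \<Rightarrow> (S - {\<iota> S m}, add_mset (\<iota> S m) m) of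
        (S, m) \<Rightarrow> (-1) ^ card S * prod z S * prod_mset (image_mset z m)) = ?f x"
    proof -
      have "card S = Suc (card (S - {\<iota> S m}))"
        by (rule card.remove[OF f x(3)])
      moreover have "prod z S = z (\<iota> S m) * prod z (S - {\<iota> S m})"
        by (rule prod.remove[OF f x(3)])
      ultimately show ?thesis using x(1) by (simp add: algebra_simps)
    qed
  next
    fix x assume "x \<in> ?X0"
    then obtain S m where x: "x = (S, m)" "(S, m) \<in> X" "\<iota> S m \<notin> S" by auto
    note o = into[OF x(2,3)]
    show "(case case x of (S, m) \<Rightarrow> (insert (\<iota> S m) S, m - {#\<iota> S m#}) of
        (S, m) \<Rightarrow> (S - {\<iota> S m}, add_mset (\<iota> S m) m)) = x"
      using o x(3) unfolding x(1) by simp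
    show "(case x of (S, m) \<Rightarrow> (insert (\<iota> S m) S, m - {#\<iota> S m#})) \<in> ?X1"
      using o unfolding x(1) by simp
  qed
  moreover have "sum ?f X = sum ?f ?X1 + sum ?f ?X0"
  proof -
    have "finite ?X1" "finite ?X0"
      by (rule finite_subset[OF _ fin(1)]; auto)+
    then show ?thesis
      by (subst sum.union_disjoint[symmetric]) (auto intro!: sum.cong)
  qed
  ultimately show ?thesis by (simp add: sum_negf)
qed

lemma finite_multisets_size:
  assumes "finite I"
  shows "finite {m. set_mset m \<subseteq> I \<and> size m = k}"
proof (rule finite_subset)
  show "{m. set_mset m \<subseteq> I \<and> size m = k} \<subseteq> mset ` {xs. set xs \<subseteq> I \<and> length xs = k}"
  proof
    fix m assume m: "m \<in> {m. set_mset m \<subseteq> I \<and> size m = k}"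
    obtain xs where "mset xs = m" using ex_mset by blast
    with m show "m \<in> mset ` {xs. set xs \<subseteq> I \<and> length xs = k}" by auto
  qed
  show "finite (mset ` {xs. set xs \<subseteq> I \<and> length xs = k})"
    using finite_lists_length_eq[OF assms] by simp
qed

text \<open>
  The index set of the alternating sum once the terms of the sequence are written as sums over the
  multisets in \<open>M\<close>; these pairs also index a graded piece of a Koszul complex.
\<close>

definition koszul_pairs :: "'i set \<Rightarrow> 'i multiset set \<Rightarrow> nat \<Rightarrow> ('i set \<times> 'i multiset) set" where
  "koszul_pairs I M K = {(S, m). S \<subseteq> I \<and> m \<in> M \<and> set_mset m \<subseteq> I \<and> card S + size m = K}"

lemma finite_koszul_pairs:
  assumes "finite I"
  shows "finite (koszul_pairs I M K)"
proof (rule finite_subset)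
  show "koszul_pairs I M K \<subseteq> (SIGMA S:Pow I. {m. set_mset m \<subseteq> I \<and> size m = K - card S})"
    by (auto simp: koszul_pairs_def)
  show "finite (SIGMA S:Pow I. {m. set_mset m \<subseteq> I \<and> size m = K - card S})"
    using assms by (intro finite_SigmaI finite_multisets_size) auto
qed

lemma alternating_sum_eq_koszul_sum:
  fixes z :: "'i \<Rightarrow> 'a::comm_ring_1"
  assumes "finite I" "card I \<le> K"
  shows "(\<Sum>S\<in>Pow I. (-1) ^ card S * prod z S *
      (\<Sum>m | m \<in> M \<and> set_mset m \<subseteq> I \<and> size m = K - card S. prod_mset (image_mset z m))) =
    (\<Sum>(S, m)\<in>koszul_pairs I M K. (-1) ^ card S * prod z S * prod_mset (image_mset z m))"
proof -
  have "koszul_pairs I M K = (SIGMA S:Pow I. {m. m \<in> M \<and> set_mset m \<subseteq> I \<and> size m = K - card S})"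
  proof -
    have "card S \<le> K" if "S \<subseteq> I" for S
      using card_mono[OF assms(1) that] assms(2) by simp
    then have "card S + n = K \<longleftrightarrow> n = K - card S" if "S \<subseteq> I" for S n
      using that by fastforce
    then show ?thesis by (auto simp: koszul_pairs_def)
  qed
  moreover have "finite {m. m \<in> M \<and> set_mset m \<subseteq> I \<and> size m = K - card S}" for S
    by (rule finite_subset[OF _ finite_multisets_size[OF assms(1), of "K - card S"]]) auto
  ultimately show ?thesis
    using assms(1) by (auto simp: sum_distrib_left intro!: sum.Sigma)
qed

text \<open>
  An element occurring more than \<open>e\<close> times in \<open>mset_set S + m\<close> occurs at least \<open>e\<close> times in \<open>m\<close> after
  it has been moved into \<open>S\<close>, so by stability moving it preserves membership in \<open>M\<close>. As the choice
  depends only on \<open>mset_set S + m\<close>, which a move does not alter, it defines an involution.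
\<close>

lemma koszul_sum_repeated:
  fixes z :: "'i \<Rightarrow> 'a::comm_ring_1"
  assumes "finite I"
    and stable: "\<And>m i. set_mset m \<subseteq> I \<Longrightarrow> i \<in> I \<Longrightarrow> e \<le> count m i \<Longrightarrow> add_mset i m \<in> M \<longleftrightarrow> m \<in> M"
  shows "(\<Sum>(S, m)\<in>{(S, m)\<in>koszul_pairs I M K. \<exists>i\<in>I. e < count (mset_set S + m) i}.
      (-1) ^ card S * prod z S * prod_mset (image_mset z m)) = 0"
proof (rule toggle_sum_zero[where \<iota> = "\<lambda>S m. SOME i. i \<in> I \<and> e < count (mset_set S + m) i"])
  let ?\<iota> = "\<lambda>S m. SOME i. i \<in> I \<and> e < count (mset_set S + m) i"
  let ?X = "{(S, m)\<in>koszul_pairs I M K. \<exists>i\<in>I. e < count (mset_set S + m) i}"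
  show "finite ?X"
    using finite_koszul_pairs[OF assms(1), of M K] by (rule rev_finite_subset) auto
  show fS: "finite S" if "(S, m) \<in> ?X" for S m
    using that assms(1) by (auto simp: koszul_pairs_def intro: finite_subset)
  have \<iota>: "?\<iota> S m \<in> I" "e < count (mset_set S + m) (?\<iota> S m)" if "(S, m) \<in> ?X" for S m
  proof -
    have "\<exists>i. i \<in> I \<and> e < count (mset_set S + m) i" using that by blast
    from someI_ex[OF this] show "?\<iota> S m \<in> I" "e < count (mset_set S + m) (?\<iota> S m)" by blast+
  qed
  fix S m assume X: "(S, m) \<in> ?X"
  define i where "i = ?\<iota> S m"
  note i = \<iota>[OF X, folded i_def]
  note fS = fS[OF X]
  have m: "set_mset m \<subseteq> I" "m \<in> M" "S \<subseteq> I" "card S + size m = K"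
    using X by (auto simp: koszul_pairs_def)
  show "(S - {?\<iota> S m}, add_mset (?\<iota> S m) m) \<in> ?X \<and> ?\<iota> (S - {?\<iota> S m}) (add_mset (?\<iota> S m) m) = ?\<iota> S m"
    if "?\<iota> S m \<in> S" unfolding i_def[symmetric]
  proof -
    have iS: "i \<in> S" using that by (simp add: i_def)
    have W: "mset_set (S - {i}) + add_mset i m = mset_set S + m"
      using fS iS by (simp add: mset_set.remove)
    have "e \<le> count m i" using i(2) iS fS by simp
    then have "add_mset i m \<in> M" using stable m i by blast
    moreover have "card (S - {i}) + size (add_mset i m) = K"
      using m(4) card.remove[OF fS iS] by simp
    ultimately have "(S - {i}, add_mset i m) \<in> koszul_pairs I M K"
      using m i by (auto simp: koszul_pairs_def)
    then show "(S - {i}, add_mset i m) \<in> ?X \<and> ?\<iota> (S - {i}) (add_mset i m) = i"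
      unfolding mem_Collect_eq prod.case W using i i_def by blast
  qed
  show "?\<iota> S m \<in># m \<and> (insert (?\<iota> S m) S, m - {#?\<iota> S m#}) \<in> ?X \<and>
      ?\<iota> (insert (?\<iota> S m) S) (m - {#?\<iota> S m#}) = ?\<iota> S m"
    if "?\<iota> S m \<notin> S" unfolding i_def[symmetric]
  proof -
    have iS: "i \<notin> S" using that by (simp add: i_def)
    have c: "e < count m i" using i(2) iS fS by simp
    then have im: "i \<in># m" by (simp add: count_greater_zero_iff[symmetric] del: count_greater_zero_iff)
    then obtain m' where m': "m = add_mset i m'" by (metis insert_DiffM)
    have W: "mset_set (insert i S) + m' = mset_set S + m"
      using fS iS m' by simp
    have "e \<le> count m' i" using c m' by simp
    then have "m' \<in> M" using stable[of m' i] m i m' by auto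
    moreover have "card (insert i S) + size m' = K"
      using m(4) fS iS m' by simp
    ultimately have "(insert i S, m') \<in> koszul_pairs I M K"
      using m i m' by (auto simp: koszul_pairs_def)
    then have "(insert i S, m') \<in> ?X \<and> ?\<iota> (insert i S) m' = i"
      unfolding mem_Collect_eq prod.case W using i i_def by blast
    then show "i \<in># m \<and> (insert i S, m - {#i#}) \<in> ?X \<and> ?\<iota> (insert i S) (m - {#i#}) = i"
      using m' by simp
  qed
qed

lemma exists_repeated:
  assumes "finite I" "set_mset m \<subseteq> I" "card I * e < size m"
  shows "\<exists>i\<in>I. e < count m i"
proof (rule ccontr)
  assume "\<not> ?thesis"
  then have "(\<Sum>i\<in>I. count m i) \<le> card I * e"
    using sum_bounded_above[of I "count m" e] by (simp add: not_less)
  moreover have "size m = (\<Sum>i\<in>I. count m i)"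
    using assms unfolding size_multiset_overloaded_eq
    by (intro sum.mono_neutral_left) (auto simp: not_in_iff)
  ultimately show False using assms by simp
qed

text \<open>
  For large \<open>K\<close> the pigeonhole principle puts a repeated element into every pair, so that nothing
  survives the cancellation.
\<close>

lemma stable_multisets_recurrence:
  fixes z :: "'i \<Rightarrow> 'a::comm_ring_1"
  assumes "finite I"
    and "\<And>m i. set_mset m \<subseteq> I \<Longrightarrow> i \<in> I \<Longrightarrow> e \<le> count m i \<Longrightarrow> add_mset i m \<in> M \<longleftrightarrow> m \<in> M"
    and "card I \<le> K" "card I * e < K"
  shows "(\<Sum>S\<in>Pow I. (-1) ^ card S * prod z S *
      (\<Sum>m | m \<in> M \<and> set_mset m \<subseteq> I \<and> size m = K - card S. prod_mset (image_mset z m))) = 0"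
proof -
  have "koszul_pairs I M K = {(S, m)\<in>koszul_pairs I M K. \<exists>i\<in>I. e < count (mset_set S + m) i}"
  proof -
    have "\<exists>i\<in>I. e < count (mset_set S + m) i" if "(S, m) \<in> koszul_pairs I M K" for S m
      using that assms(1,4) finite_subset[of S I]
      by (intro exists_repeated) (auto simp: koszul_pairs_def)
    then show ?thesis by auto
  qed
  note repeated = this
  show ?thesis
    unfolding alternating_sum_eq_koszul_sum[OF assms(1,3)]
    by (subst repeated) (rule koszul_sum_repeated[OF assms(1,2)])
qed

section \<open>Stability of down-closed families of multisets\<close>

text \<open>
  A monotone subsequence that decreases attains its minimum and is constant from there on.
\<close>

lemma nat_seq_incseq_subseq:
  fixes s :: "nat \<Rightarrow> nat"
  shows "\<exists>h::nat \<Rightarrow> nat. strict_mono h \<and> mono (s \<circ> h)"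
proof -
  obtain f where f: "strict_mono f" "monoseq (\<lambda>n. s (f n))"
    using seq_monosub by blast
  show ?thesis
  proof (cases "incseq (\<lambda>n. s (f n))")
    case True
    with f(1) show ?thesis unfolding comp_def by blast
  next
    case False
    then have dec: "decseq (\<lambda>n. s (f n))"
      using f(2) by (simp add: monoseq_iff)
    obtain N where N: "\<And>n. s (f N) \<le> s (f n)"
      using ex_has_least_nat[of "\<lambda>_. True" _ "\<lambda>n. s (f n)"] by blast
    have "s (f (N + n)) = s (f N)" for n
      using N[of "N + n"] decseqD[OF dec, of N "N + n"] by simp
    then have "mono (s \<circ> (\<lambda>n. f (N + n)))" by (simp add: mono_def)
    moreover have "strict_mono (\<lambda>n. f (N + n))"
      using f(1) by (simp add: strict_mono_def)
    ultimately show ?thesis by blast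
  qed
qed

text \<open>
  Dickson's lemma in sequence form: one coordinate after the other is made monotone by passing to a
  subsequence.
\<close>

lemma dickson_subseq:
  fixes s :: "nat \<Rightarrow> 'i \<Rightarrow> nat"
  assumes "finite I"
  shows "\<exists>h::nat \<Rightarrow> nat. strict_mono h \<and> (\<forall>i\<in>I. mono (\<lambda>n. s (h n) i))"
  using assms
proof (induction I rule: finite_induct)
  case empty
  show ?case by (intro exI[of _ id]) (simp add: strict_mono_def)
next
  case (insert x I)
  then obtain h :: "nat \<Rightarrow> nat" where h: "strict_mono h" "\<forall>i\<in>I. mono (\<lambda>n. s (h n) i)" by blast
  obtain g :: "nat \<Rightarrow> nat" where g: "strict_mono g" "mono ((\<lambda>n. s (h n) x) \<circ> g)"
    using nat_seq_incseq_subseq by blast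
  have "strict_mono (h \<circ> g)" using h(1) g(1) by (rule strict_mono_o)
  moreover have "mono (\<lambda>n. s ((h \<circ> g) n) i)" if "i \<in> insert x I" for i
  proof (cases "i = x")
    case True
    with g show ?thesis by (simp add: comp_def)
  next
    case False
    then have "mono (\<lambda>n. s (h n) i)" using that h by auto
    then show ?thesis using strict_mono_mono[OF g(1)] by (simp add: mono_def)
  qed
  ultimately show ?case by blast
qed

text \<open>
  If no bound worked for \<open>i\<close>, there would be members \<open>s e\<close> of \<open>M\<close> with at least \<open>e\<close> copies of \<open>i\<close>, to
  which \<open>i\<close> cannot be added. In a subsequence growing in all coordinates, a late term contains the
  first one together with a further copy of \<open>i\<close>, which is then in \<open>M\<close> after all.
\<close>

lemma downclosed_stable:
  fixes M :: "'i multiset set"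
  assumes "finite I"
    and down: "\<And>m i. set_mset m \<subseteq> I \<Longrightarrow> i \<in> I \<Longrightarrow> add_mset i m \<in> M \<Longrightarrow> m \<in> M"
  obtains e where "\<And>m i. set_mset m \<subseteq> I \<Longrightarrow> i \<in> I \<Longrightarrow> e \<le> count m i \<Longrightarrow> add_mset i m \<in> M \<longleftrightarrow> m \<in> M"
proof -
  have down': "m + m' \<in> M \<Longrightarrow> set_mset (m + m') \<subseteq> I \<Longrightarrow> m \<in> M" for m m'
  proof (induction m')
    case (add x m')
    then have "m + m' \<in> M" using down[of "m + m'" x] by simp
    then show ?case using add by simp
  qed simp
  have "\<exists>e. \<forall>m. set_mset m \<subseteq> I \<longrightarrow> e \<le> count m i \<longrightarrow> m \<in> M \<longrightarrow> add_mset i m \<in> M" if "i \<in> I" for i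
  proof (rule ccontr)
    assume "\<not> ?thesis"
    then have "\<forall>e. \<exists>m. set_mset m \<subseteq> I \<and> e \<le> count m i \<and> m \<in> M \<and> add_mset i m \<notin> M" by blast
    then obtain s where s: "\<And>e. set_mset (s e) \<subseteq> I" "\<And>e. e \<le> count (s e) i" "\<And>e. s e \<in> M"
        "\<And>e. add_mset i (s e) \<notin> M"
      by metis
    obtain h :: "nat \<Rightarrow> nat" where h: "strict_mono h" "\<And>j. j \<in> I \<Longrightarrow> mono (\<lambda>n. count (s (h n)) j)"
      using dickson_subseq[OF assms(1), of "\<lambda>n. count (s n)"] by blast
    \<comment> \<open>far enough for the late term to have one more \<open>i\<close> than the first term\<close>
    define N where "N = Suc (count (s (h 0)) i)"
    have "count (add_mset i (s (h 0))) j \<le> count (s (h N)) j" for j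
    proof (cases "j = i")
      case True
      have "N \<le> h N" using h(1) by (rule strict_mono_imp_increasing)
      also have "h N \<le> count (s (h N)) i" by (rule s)
      finally show ?thesis using True by (simp add: N_def)
    next
      case False
      show ?thesis
      proof (cases "j \<in> I")
        case True
        then show ?thesis using False monoD[OF h(2)[OF True], of 0 N] by simp
      next
        case jI: False
        then have "j \<notin># s (h 0)" using s(1) by blast
        then show ?thesis using False by (simp add: not_in_iff)
      qed
    qed
    then obtain m' where "s (h N) = add_mset i (s (h 0)) + m'"
      using mset_subset_eq_exists_conv by (metis subseteq_mset_def)
    then have "add_mset i (s (h 0)) \<in> M"
      using down'[of "add_mset i (s (h 0))" m'] s(1,3) by metis
    then show False using s(4) by blast
  qed
  then have "\<forall>i\<in>I. \<exists>e. \<forall>m. set_mset m \<subseteq> I \<longrightarrow> e \<le> count m i \<longrightarrow> m \<in> M \<longrightarrow> add_mset i m \<in> M"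
    by blast
  from bchoice[OF this] obtain e where e: "\<And>i m. i \<in> I \<Longrightarrow> set_mset m \<subseteq> I \<Longrightarrow> e i \<le> count m i \<Longrightarrow> m \<in> M \<Longrightarrow>
      add_mset i m \<in> M"
    by blast
  show ?thesis
  proof (rule that[of "sum e I"])
    fix m i assume m: "set_mset m \<subseteq> I" "i \<in> I" "sum e I \<le> count m i"
    have "e i \<le> sum e I" using assms(1) m(2) by (intro member_le_sum) auto
    then show "add_mset i m \<in> M \<longleftrightarrow> m \<in> M"
      using e[OF m(2,1)] down[OF m(1,2)] m(3) by fastforce
  qed
qed

section \<open>Recurrences for finitely generated graded families\<close>

text \<open>
  Elements of a graded family are represented as a generator \<open>\<gamma> j\<close> plus a sum of the \<open>\<alpha> i\<close>. Indexing
  by natural numbers provides the well-orders that single out one representation of each element.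
\<close>

definition rep_value :: "(nat \<Rightarrow> 'p::comm_monoid_add) \<Rightarrow> (nat \<Rightarrow> 'p) \<Rightarrow> nat \<Rightarrow> nat multiset \<Rightarrow> 'p" where
  "rep_value \<gamma> \<alpha> j m = \<gamma> j + \<Sum>\<^sub># (image_mset \<alpha> m)"

definition canonical_rep ::
    "(nat \<Rightarrow> 'p::comm_monoid_add) \<Rightarrow> (nat \<Rightarrow> 'p) \<Rightarrow> nat set \<Rightarrow> nat set \<Rightarrow> nat \<Rightarrow> nat multiset \<Rightarrow> bool" where
  "canonical_rep \<gamma> \<alpha> J I j m \<longleftrightarrow> j \<in> J \<and> set_mset m \<subseteq> I \<and>
     (\<forall>j'\<in>J. \<forall>m'. set_mset m' \<subseteq> I \<longrightarrow> size m' = size m \<longrightarrow> rep_value \<gamma> \<alpha> j' m' = rep_value \<gamma> \<alpha> j m \<longrightarrow>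
        j < j' \<or> j = j' \<and> m \<le> m')"

lemma canonical_rep_exists:
  assumes "j \<in> J" "set_mset m \<subseteq> I"
  obtains j' m' where "canonical_rep \<gamma> \<alpha> J I j' m'" "size m' = size m"
    "rep_value \<gamma> \<alpha> j' m' = rep_value \<gamma> \<alpha> j m"
proof -
  define P where "P = (\<lambda>j' m'. j' \<in> J \<and> set_mset m' \<subseteq> I \<and> size m' = size m \<and>
      rep_value \<gamma> \<alpha> j' m' = rep_value \<gamma> \<alpha> j m)"
  have "P j m" using assms by (simp add: P_def)
  define j0 where "j0 = (LEAST j'. \<exists>m'. P j' m')"
  define m0 where "m0 = (LEAST m'. P j0 m')"
  have "\<exists>m'. P j0 m'"
    unfolding j0_def using exI[of "P j" m, OF \<open>P j m\<close>] by (rule LeastI[of "\<lambda>j'. \<exists>m'. P j' m'" j])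
  then have P: "P j0 m0" unfolding m0_def by (rule LeastI_ex)
  have least: "j0 < j' \<or> j0 = j' \<and> m0 \<le> m'" if "P j' m'" for j' m'
  proof -
    have "j0 \<le> j'" unfolding j0_def using that by (intro Least_le) blast
    moreover have "m0 \<le> m'" if "j0 = j'"
      unfolding m0_def using \<open>P j' m'\<close> that by (intro Least_le) simp
    ultimately show ?thesis unfolding le_less by metis
  qed
  have "canonical_rep \<gamma> \<alpha> J I j0 m0"
    using P least unfolding canonical_rep_def P_def by simp
  then show ?thesis using that P unfolding P_def by blast
qed

lemma canonical_rep_unique:
  assumes "canonical_rep \<gamma> \<alpha> J I j m" "canonical_rep \<gamma> \<alpha> J I j' m'"
    and "size m = size m'" "rep_value \<gamma> \<alpha> j m = rep_value \<gamma> \<alpha> j' m'"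
  shows "j = j' \<and> m = m'"
proof -
  have "j < j' \<or> j = j' \<and> m \<le> m'" "j' < j \<or> j' = j \<and> m' \<le> m"
    using assms unfolding canonical_rep_def by metis+
  then show ?thesis by auto
qed

text \<open>
  The multiset order is compatible with addition: a better representation for \<open>m\<close> would give a better
  one for \<open>add_mset i m\<close>. In algebraic terms, the monomials outside an initial ideal are closed under
  divisors.
\<close>

lemma canonical_rep_downclosed:
  assumes "canonical_rep \<gamma> \<alpha> J I j (add_mset i m)"
  shows "canonical_rep \<gamma> \<alpha> J I j m"
  unfolding canonical_rep_def
proof (intro conjI ballI allI impI)
  show "j \<in> J" "set_mset m \<subseteq> I" using assms by (auto simp: canonical_rep_def)
  fix j' m' assume m': "j' \<in> J" "set_mset m' \<subseteq> I" "size m' = size m"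
    "rep_value \<gamma> \<alpha> j' m' = rep_value \<gamma> \<alpha> j m"
  have "rep_value \<gamma> \<alpha> j' (add_mset i m') = rep_value \<gamma> \<alpha> j (add_mset i m)"
    using m'(4) unfolding rep_value_def by (simp add: add.left_commute)
  moreover have "set_mset (add_mset i m') \<subseteq> I" "size (add_mset i m') = size (add_mset i m)"
    using m' assms by (auto simp: canonical_rep_def)
  ultimately have "j < j' \<or> j = j' \<and> add_mset i m \<le> add_mset i m'"
    using assms m'(1) unfolding canonical_rep_def by blast
  moreover have "m \<le> m'" if "add_mset i m \<le> add_mset i m'"
    using that add_le_cancel_right[of m "{#i#}" m'] by simp
  ultimately show "j < j' \<or> j = j' \<and> m \<le> m'" by blast
qed

text \<open>
  This plays the role of the theorem of Hilbert and Serre on the rationality of Hilbert series. From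
  degree \<open>r\<close> on, canonical representations identify \<open>G\<close> with finitely many copies of down-closed
  families of multisets, one for each generator in degree \<open>r\<close>, and each of these is stable.
\<close>

lemma finitely_generated_recurrence:
  fixes G :: "nat \<Rightarrow> 'p::comm_monoid_add set" and \<alpha> :: "nat \<Rightarrow> 'p" and z :: "'p \<Rightarrow> 'a::comm_ring_1"
  assumes "finite I" "finite (G r)"
    and closed: "\<And>k Q i. r \<le> k \<Longrightarrow> Q \<in> G k \<Longrightarrow> i \<in> I \<Longrightarrow> Q + \<alpha> i \<in> G (Suc k)"
    and generated: "\<And>k Q. r \<le> k \<Longrightarrow> Q \<in> G (Suc k) \<Longrightarrow> \<exists>i\<in>I. \<exists>P\<in>G k. Q = P + \<alpha> i"
    and z: "\<And>k Q i. r \<le> k \<Longrightarrow> Q \<in> G k \<Longrightarrow> i \<in> I \<Longrightarrow> z (Q + \<alpha> i) = z Q * z (\<alpha> i)"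
  shows "\<exists>r0. \<forall>k\<ge>r0. (\<Sum>S\<in>Pow I. (-1) ^ card S * (\<Prod>i\<in>S. z (\<alpha> i)) *
    (\<Sum>Q\<in>G (k + card I - card S). z Q)) = 0"
proof -
  obtain \<gamma> :: "nat \<Rightarrow> 'p" and J where J: "finite J" "\<gamma> ` J = G r"
    using finite_imp_nat_seg_image_inj_on[OF assms(2)] by (metis finite_Collect_less_nat)
  let ?v = "rep_value \<gamma> \<alpha>"
  let ?C = "canonical_rep \<gamma> \<alpha> J I"
  define M where "M j = {m. ?C j m}" for j
  define h where "h j s = (\<Sum>m | m \<in> M j \<and> set_mset m \<subseteq> I \<and> size m = s. \<Prod>\<^sub># (image_mset (\<lambda>i. z (\<alpha> i)) m))" for j s
  have rep_add: "?v j (add_mset i m) = ?v j m + \<alpha> i" for j i m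
    by (simp add: rep_value_def add.commute add.left_commute)
  have rep_in_G: "?v j m \<in> G (r + size m) \<and> z (?v j m) = z (\<gamma> j) * \<Prod>\<^sub># (image_mset (\<lambda>i. z (\<alpha> i)) m)"
    if "j \<in> J" "set_mset m \<subseteq> I" for j m
    using that(2)
  proof (induction m)
    case empty
    then show ?case using J(2) that(1) by (auto simp: rep_value_def)
  next
    case (add i m)
    then have IH: "?v j m \<in> G (r + size m)" "z (?v j m) = z (\<gamma> j) * \<Prod>\<^sub># (image_mset (\<lambda>i. z (\<alpha> i)) m)"
      and i: "i \<in> I" by auto
    show ?case
      unfolding rep_add using closed[OF _ IH(1) i] z[OF _ IH(1) i] IH(2) by (simp add: mult_ac)
  qed
  have represented: "\<exists>j\<in>J. \<exists>m. set_mset m \<subseteq> I \<and> size m = s \<and> ?v j m = Q" if "Q \<in> G (r + s)" for s Q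
    using that
  proof (induction s arbitrary: Q)
    case 0
    then obtain j where "j \<in> J" "\<gamma> j = Q" using J(2) by (metis add_0_right imageE)
    then show ?case by (intro bexI[of _ j] exI[of _ "{#}"]) (auto simp: rep_value_def)
  next
    case (Suc s)
    then obtain i P where i: "i \<in> I" "P \<in> G (r + s)" "Q = P + \<alpha> i"
      using generated[of "r + s" Q] by auto
    then obtain j m where "j \<in> J" "set_mset m \<subseteq> I" "size m = s" "?v j m = P"
      using Suc.IH by blast
    then show ?case using i by (intro bexI[of _ j] exI[of _ "add_mset i m"]) (auto simp: rep_add)
  qed
  have finM: "finite {m. m \<in> M j \<and> set_mset m \<subseteq> I \<and> size m = s}" for j s
    by (rule finite_subset[OF _ finite_multisets_size[OF assms(1), of s]]) auto
  have sum_G: "(\<Sum>Q\<in>G (r + s). z Q) = (\<Sum>j\<in>J. z (\<gamma> j) * h j s)" for s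
  proof -
    let ?D = "SIGMA j:J. {m. m \<in> M j \<and> set_mset m \<subseteq> I \<and> size m = s}"
    have inj: "inj_on (\<lambda>(j, m). ?v j m) ?D"
      unfolding inj_on_def M_def by (auto dest: canonical_rep_unique)
    have img: "(\<lambda>(j, m). ?v j m) ` ?D = G (r + s)"
    proof (intro equalityI subsetI)
      fix Q assume "Q \<in> (\<lambda>(j, m). ?v j m) ` ?D"
      then show "Q \<in> G (r + s)" using rep_in_G by auto
    next
      fix Q assume "Q \<in> G (r + s)"
      then obtain j m where "j \<in> J" "set_mset m \<subseteq> I" "size m = s" "?v j m = Q"
        using represented by blast
      then obtain j' m' where C: "?C j' m'" "size m' = s" "?v j' m' = Q"
        using canonical_rep_exists[of j J m I \<gamma> \<alpha>] by metis
      then have "(j', m') \<in> ?D" by (auto simp: M_def canonical_rep_def)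
      then show "Q \<in> (\<lambda>(j, m). ?v j m) ` ?D" using C(3) by force
    qed
    have "(\<Sum>Q\<in>G (r + s). z Q) = (\<Sum>(j, m)\<in>?D. z (?v j m))"
      unfolding img[symmetric] sum.reindex[OF inj] by (simp add: comp_def case_prod_unfold)
    also have "\<dots> = (\<Sum>(j, m)\<in>?D. z (\<gamma> j) * \<Prod>\<^sub># (image_mset (\<lambda>i. z (\<alpha> i)) m))"
      using rep_in_G by (intro sum.cong) auto
    also have "\<dots> = (\<Sum>j\<in>J. z (\<gamma> j) * h j s)"
      unfolding h_def sum_distrib_left using J(1) finM by (intro sum.Sigma[symmetric]) auto
    finally show ?thesis .
  qed
  have "\<exists>e. \<forall>m i. set_mset m \<subseteq> I \<longrightarrow> i \<in> I \<longrightarrow> e \<le> count m i \<longrightarrow> (add_mset i m \<in> M j \<longleftrightarrow> m \<in> M j)" for j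
  proof -
    have "add_mset i m \<in> M j \<Longrightarrow> m \<in> M j" for m i
      unfolding M_def using canonical_rep_downclosed by blast
    then show ?thesis using downclosed_stable[OF assms(1), of "M j"] by metis
  qed
  then obtain e where e: "\<And>j m i. set_mset m \<subseteq> I \<Longrightarrow> i \<in> I \<Longrightarrow> e j \<le> count m i \<Longrightarrow>
      add_mset i m \<in> M j \<longleftrightarrow> m \<in> M j"
    by metis
  show ?thesis
  proof (intro exI[of _ "Suc r + card I * sum e J"] allI impI)
    fix k assume k: "Suc r + card I * sum e J \<le> k"
    \<comment> \<open>degrees counted from \<open>r\<close>, as the generators have degree \<open>r\<close> and each \<open>\<alpha> i\<close> adds 1\<close>
    define K where "K = k + card I - r"
    have "(\<Sum>Q\<in>G (k + card I - card S). z Q) = (\<Sum>j\<in>J. z (\<gamma> j) * h j (K - card S))" if "S \<in> Pow I" for S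
    proof -
      have "card S \<le> card I" using that assms(1) by (auto intro: card_mono)
      then have "k + card I - card S = r + (K - card S)" using k by (simp add: K_def)
      then show ?thesis using sum_G by simp
    qed
    then have "(\<Sum>S\<in>Pow I. (-1) ^ card S * (\<Prod>i\<in>S. z (\<alpha> i)) * (\<Sum>Q\<in>G (k + card I - card S). z Q)) =
        (\<Sum>S\<in>Pow I. \<Sum>j\<in>J. z (\<gamma> j) * ((-1) ^ card S * (\<Prod>i\<in>S. z (\<alpha> i)) * h j (K - card S)))"
      by (intro sum.cong) (auto simp: sum_distrib_left mult_ac)
    also have "\<dots> = (\<Sum>j\<in>J. z (\<gamma> j) * (\<Sum>S\<in>Pow I. (-1) ^ card S * (\<Prod>i\<in>S. z (\<alpha> i)) * h j (K - card S)))"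
      unfolding sum_distrib_left by (rule sum.swap)
    also have "\<dots> = 0"
    proof (rule sum.neutral, rule ballI)
      fix j assume "j \<in> J"
      then have "e j \<le> sum e J" using J(1) by (intro member_le_sum) auto
      then have "card I * e j \<le> card I * sum e J" by (rule mult_le_mono2)
      then have "card I * e j < K" "card I \<le> K" using k unfolding K_def by linarith+
      then show "z (\<gamma> j) * (\<Sum>S\<in>Pow I. (-1) ^ card S * (\<Prod>i\<in>S. z (\<alpha> i)) * h j (K - card S)) = 0"
        using stable_multisets_recurrence[where M = "M j" and e = "e j" and K = K and z = "\<lambda>i. z (\<alpha> i)",
            OF assms(1) e] unfolding h_def by simp
    qed
    finally show "(\<Sum>S\<in>Pow I. (-1) ^ card S * (\<Prod>i\<in>S. z (\<alpha> i)) * (\<Sum>Q\<in>G (k + card I - card S). z Q)) = 0" .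
  qed
qed

section \<open>Gelfand-Tsetlin patterns\<close>

text \<open>
  Row \<open>k\<close> of a pattern is the shape formed by \<open>q\<close> and the boxes with entries at most \<open>k\<close>; the second
  inequality says that consecutive rows differ by a horizontal strip. Rows beyond \<open>n\<close> repeat \<open>p\<close>, so
  that the pointwise sum of two patterns is a pattern for the summed shapes.
\<close>

definition gt_patterns :: "nat \<Rightarrow> (nat \<Rightarrow> nat) \<Rightarrow> (nat \<Rightarrow> nat) \<Rightarrow> (nat \<Rightarrow> nat \<Rightarrow> nat) set" where
  "gt_patterns n p q = {P. P 0 = q \<and> (\<forall>k\<ge>n. P k = p) \<and>
     (\<forall>k i. P k i \<le> P (Suc k) i \<and> P (Suc k) (Suc i) \<le> P k i)}"

definition gt_monomial :: "nat \<Rightarrow> (nat \<Rightarrow> nat \<Rightarrow> nat) \<Rightarrow> int_mpoly" where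
  "gt_monomial n P = x_power n (\<lambda>k. \<Sum>i<n. P k i - P (k - 1) i)"

lemma partition_zero_beyond_length:
  assumes "is_partition p" "partition_length p \<le> n" "n \<le> i"
  shows "p i = 0"
proof (rule ccontr)
  assume "p i \<noteq> 0"
  have "p i \<le> p j" if "j \<le> i" for j
    using assms(1) that unfolding is_partition_def by (blast intro: antimonoD)
  then have "{..i} \<subseteq> {i. p i > 0}" using \<open>p i \<noteq> 0\<close> by fastforce
  then have "card {..i} \<le> partition_length p"
    using assms(1) unfolding is_partition_def partition_length_def by (intro card_mono) auto
  then show False using assms by simp
qed

lemma gt_mono_level:
  assumes "P \<in> gt_patterns n p q" "k \<le> k'"
  shows "P k i \<le> P k' i"
  using lift_Suc_mono_le[of "\<lambda>k. P k i" k k'] assms by (auto simp: gt_patterns_def)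

lemma gt_lower: "P \<in> gt_patterns n p q \<Longrightarrow> q i \<le> P k i"
  using gt_mono_level[of P n p q 0 k i] by (simp add: gt_patterns_def)

lemma gt_upper: "P \<in> gt_patterns n p q \<Longrightarrow> P k i \<le> p i"
proof -
  assume P: "P \<in> gt_patterns n p q"
  have "P k i \<le> P (max n k) i" by (rule gt_mono_level[OF P]) simp
  then show ?thesis using P by (simp add: gt_patterns_def)
qed

lemma gt_antimono_row:
  assumes "P \<in> gt_patterns n p q" "i \<le> i'" "antimono q"
  shows "P k i' \<le> P k i"
proof -
  have "P k (Suc i) \<le> P k i" for i
  proof (cases k)
    case 0
    then show ?thesis using assms(1,3) by (simp add: gt_patterns_def antimono_iff_le_Suc)
  next
    case (Suc l)
    then have "P k (Suc i) \<le> P l i" "P l i \<le> P k i" using assms(1) by (auto simp: gt_patterns_def)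
    then show ?thesis by simp
  qed
  then show ?thesis using lift_Suc_antimono_le[of "P k"] assms(2) by blast
qed

text \<open>
  The conditions on a pattern only compare entries, so they survive any monotone map. This is how
  patterns are divided, both for general shapes and for pure multiples.
\<close>

lemma gt_patterns_comp:
  assumes "P \<in> gt_patterns n p q" "mono f"
  shows "(\<lambda>k i. f (P k i)) \<in> gt_patterns n (\<lambda>i. f (p i)) (\<lambda>i. f (q i))"
  using assms by (auto simp: gt_patterns_def mono_def)

lemma gt_patterns_add:
  assumes "P \<in> gt_patterns n p q" "A \<in> gt_patterns n p' q'"
  shows "P + A \<in> gt_patterns n (\<lambda>i. p i + p' i) (\<lambda>i. q i + q' i)"
  using assms by (auto simp: gt_patterns_def plus_fun_def add_mono)

lemma x_power_add: "x_power n (\<lambda>k. a k + b k) = x_power n a * x_power n b"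
  by (simp add: x_power_def power_add prod.distrib)

lemma gt_monomial_add:
  assumes "P \<in> gt_patterns n p q" "A \<in> gt_patterns n p' q'"
  shows "gt_monomial n (P + A) = gt_monomial n P * gt_monomial n A"
proof -
  have "(P + A) k i - (P + A) (k - 1) i = (P k i - P (k - 1) i) + (A k i - A (k - 1) i)" for k i
    using gt_mono_level[OF assms(1), of "k - 1" k i] gt_mono_level[OF assms(2), of "k - 1" k i] by simp
  then show ?thesis
    by (simp only: gt_monomial_def sum.distrib x_power_add)
qed

section \<open>Tableaux as patterns\<close>

text \<open>
  The last column of row \<open>i\<close> with an entry at most \<open>k\<close>; inserting \<open>q i\<close> covers rows without such an
  entry.
\<close>

definition gt_of_tableau :: "(nat \<Rightarrow> nat) \<Rightarrow> (nat \<Rightarrow> nat) \<Rightarrow> (nat \<times> nat \<Rightarrow> nat) \<Rightarrow> nat \<Rightarrow> nat \<Rightarrow> nat" where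
  "gt_of_tableau p q T k i = Max (insert (q i) {j. q i < j \<and> j \<le> p i \<and> T (i, j) \<le> k})"

definition tableau_of_gt :: "(nat \<Rightarrow> nat) \<Rightarrow> (nat \<Rightarrow> nat) \<Rightarrow> (nat \<Rightarrow> nat \<Rightarrow> nat) \<Rightarrow> nat \<times> nat \<Rightarrow> nat" where
  "tableau_of_gt p q P = restrict (\<lambda>(i, j). LEAST k. j \<le> P k i) (skew_diagram p q)"

lemma mem_skew_diagram [simp]: "(i, j) \<in> skew_diagram p q \<longleftrightarrow> q i < j \<and> j \<le> p i"
  by (simp add: skew_diagram_def)

text \<open>
  Rows increase weakly, so the boxes with entries at most \<open>k\<close> form an initial segment of the row and
  are described by its last column. All properties of the correspondence follow from this
  equivalence and its counterpart \<open>tableau_of_gt_le_iff\<close>.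
\<close>

lemma le_gt_of_tableau_iff:
  assumes "T \<in> ssyt n p q" "q i < j" "j \<le> p i"
  shows "j \<le> gt_of_tableau p q T k i \<longleftrightarrow> T (i, j) \<le> k"
proof -
  let ?X = "insert (q i) {j. q i < j \<and> j \<le> p i \<and> T (i, j) \<le> k}"
  have fin: "finite ?X" by (rule finite_subset[of _ "{..max (p i) (q i)}"]) auto
  show ?thesis
  proof
    assume "T (i, j) \<le> k"
    then show "j \<le> gt_of_tableau p q T k i"
      unfolding gt_of_tableau_def using fin assms by (intro Max_ge) auto
  next
    assume j: "j \<le> gt_of_tableau p q T k i"
    define j' where "j' = gt_of_tableau p q T k i"
    have "j' \<in> ?X" unfolding j'_def gt_of_tableau_def using fin by (intro Max_in) auto
    then have j': "q i < j'" "j' \<le> p i" "T (i, j') \<le> k" using j assms(2) by (auto simp: j'_def)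
    have "T (i, j) \<le> T (i, j')"
    proof (cases "j = j'")
      case False
      then have "j < j'" using j by (simp add: j'_def)
      then show ?thesis using assms j' unfolding ssyt_def by auto
    qed simp
    with j' show "T (i, j) \<le> k" by simp
  qed
qed

lemma gt_of_tableau_bounds:
  assumes "q i \<le> p i"
  shows "q i \<le> gt_of_tableau p q T k i" "gt_of_tableau p q T k i \<le> p i"
proof -
  have "finite (insert (q i) {j. q i < j \<and> j \<le> p i \<and> T (i, j) \<le> k})"
    by (rule finite_subset[of _ "{..max (p i) (q i)}"]) auto
  then show "q i \<le> gt_of_tableau p q T k i" "gt_of_tableau p q T k i \<le> p i"
    unfolding gt_of_tableau_def using assms by (auto intro!: Max.boundedI)
qed

text \<open>
  Equality of two row lengths can be tested on the boxes of the row.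
\<close>

lemma nat_eqI_le_iff:
  fixes a b l u :: nat
  assumes "l \<le> a" "a \<le> u" "l \<le> b" "b \<le> u" "\<And>j. l < j \<Longrightarrow> j \<le> u \<Longrightarrow> j \<le> a \<longleftrightarrow> j \<le> b"
  shows "a = b"
proof (rule antisym)
  show "a \<le> b" using assms(5)[of a] assms by (cases "l = a") auto
  show "b \<le> a" using assms(5)[of b] assms by (cases "l = b") auto
qed

lemma ssyt_range:
  assumes "T \<in> ssyt n p q" "q i < j" "j \<le> p i"
  shows "1 \<le> T (i, j)" "T (i, j) \<le> n"
proof -
  have "T \<in> skew_diagram p q \<rightarrow>\<^sub>E {1..n}" using assms(1) by (simp add: ssyt_def)
  then have "T (i, j) \<in> {1..n}" by (rule PiE_mem) (simp add: assms)
  then show "1 \<le> T (i, j)" "T (i, j) \<le> n" by auto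
qed

lemma gt_of_tableau_in_gt:
  assumes T: "T \<in> ssyt n p q" and "q \<le> p" "antimono p" "antimono q"
  shows "gt_of_tableau p q T \<in> gt_patterns n p q"
proof -
  let ?P = "gt_of_tableau p q T"
  have qp: "q i \<le> p i" for i using assms(2) by (simp add: le_fun_def)
  note le = le_gt_of_tableau_iff[OF T] and bounds = gt_of_tableau_bounds[where p = p and q = q and T = T, OF qp]
  have 1: "?P 0 i = q i" for i
  proof (rule nat_eqI_le_iff[of "q i" _ "p i"])
    fix j assume "q i < j" "j \<le> p i"
    then show "j \<le> ?P 0 i \<longleftrightarrow> j \<le> q i"
      using ssyt_range[OF T, of i j] le[of i j 0] by auto
  qed (use bounds qp in auto)
  have 2: "?P k i = p i" if "n \<le> k" for k i
  proof (rule nat_eqI_le_iff[of "q i" _ "p i"])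
    fix j assume "q i < j" "j \<le> p i"
    then show "j \<le> ?P k i \<longleftrightarrow> j \<le> p i"
      using ssyt_range[OF T, of i j] le[of i j k] that by auto
  qed (use bounds qp in auto)
  have 3: "?P k i \<le> ?P (Suc k) i" for k i
  proof (rule ccontr)
    assume "\<not> ?thesis"
    then have *: "?P (Suc k) i < ?P k i" by simp
    then have "q i < ?P k i" using bounds(1)[of i "Suc k"] by simp
    then show False using * le[of i "?P k i" k] le[of i "?P k i" "Suc k"] bounds(2)[of k i] by auto
  qed
  have 4: "?P (Suc k) (Suc i) \<le> ?P k i" for k i
  proof (rule ccontr)
    let ?j = "?P (Suc k) (Suc i)"
    assume "\<not> ?thesis"
    then have *: "?P k i < ?j" by simp
    have "q (Suc i) \<le> q i" "p (Suc i) \<le> p i" using antimonoD[OF assms(4), of i "Suc i"] antimonoD[OF assms(3), of i "Suc i"] by auto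
    then have j: "q i < ?j" "?j \<le> p i" "q (Suc i) < ?j" "?j \<le> p (Suc i)"
      using * bounds(1)[of i k] bounds(2)[of "Suc k" "Suc i"] by auto
    then have "T (Suc i, ?j) \<le> Suc k" using le[of "Suc i" ?j "Suc k"] by simp
    moreover have "T (i, ?j) < T (Suc i, ?j)"
    proof -
      have "\<forall>i i' j. (i, j) \<in> skew_diagram p q \<and> (i', j) \<in> skew_diagram p q \<and> i < i' \<longrightarrow> T (i, j) < T (i', j)"
        using T unfolding ssyt_def mem_Collect_eq by (elim conjE)
      then show ?thesis using j by simp
    qed
    ultimately have "?j \<le> ?P k i" using le[of i ?j k] j by simp
    then show False using * by simp
  qed
  show ?thesis unfolding gt_patterns_def using 1 2 3 4 by auto
qed

lemma tableau_of_gt_le_iff: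
  assumes P: "P \<in> gt_patterns n p q" and "q i < j" "j \<le> p i"
  shows "tableau_of_gt p q P (i, j) \<le> k \<longleftrightarrow> j \<le> P k i"
proof -
  have eq: "tableau_of_gt p q P (i, j) = (LEAST k. j \<le> P k i)"
    using assms by (simp add: tableau_of_gt_def)
  have "j \<le> P n i" using P assms(3) by (simp add: gt_patterns_def)
  then have least: "j \<le> P (LEAST k. j \<le> P k i) i" by (rule LeastI)
  show ?thesis unfolding eq
    using gt_mono_level[OF P] least by (meson Least_le order_trans)
qed

lemma tableau_of_gt_in_ssyt:
  assumes P: "P \<in> gt_patterns n p q" and "antimono q"
  shows "tableau_of_gt p q P \<in> ssyt n p q"
proof -
  let ?T = "tableau_of_gt p q P"
  note le = tableau_of_gt_le_iff[OF P]
  have "?T \<in> skew_diagram p q \<rightarrow>\<^sub>E {1..n}"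
  proof (rule PiE_I)
    fix b assume "b \<in> skew_diagram p q"
    then obtain i j where b: "b = (i, j)" "q i < j" "j \<le> p i" by (cases b) auto
    have "?T (i, j) \<le> n" using le[OF b(2,3), of n] P b by (simp add: gt_patterns_def)
    moreover have "\<not> ?T (i, j) \<le> 0" using le[OF b(2,3), of 0] P b by (simp add: gt_patterns_def)
    ultimately show "?T b \<in> {1..n}" using b by auto
  qed (simp add: tableau_of_gt_def)
  moreover have "?T (i, j) \<le> ?T (i, j')"
    if "q i < j" "j \<le> p i" "q i < j'" "j' \<le> p i" "j < j'" for i j j'
    using le[of i j "?T (i, j')"] le[of i j' "?T (i, j')"] that by auto
  moreover have "?T (i, j) < ?T (i', j)"
    if ij: "q i < j" "j \<le> p i" "q i' < j" "j \<le> p i'" "i < i'" for i i' j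
  proof -
    let ?k = "?T (i', j)"
    have j: "j \<le> P ?k i'" using le[of i' j ?k] ij by simp
    have "?k \<noteq> 0"
    proof
      assume "?k = 0"
      with j have "j \<le> P 0 i'" by simp
      then show False using ij P by (simp add: gt_patterns_def)
    qed
    then obtain k where k: "?k = Suc k" by (cases ?k) auto
    obtain i0 where i0: "i' = Suc i0" "i \<le> i0" using ij(5) by (cases i') auto
    have "j \<le> P k i0" using j k i0 P by (auto simp: gt_patterns_def intro: order_trans)
    also have "\<dots> \<le> P k i" by (rule gt_antimono_row[OF P i0(2) assms(2)])
    finally have "?T (i, j) \<le> k" using le[of i j k] ij by simp
    then show ?thesis using k by simp
  qed
  ultimately show ?thesis unfolding ssyt_def by auto
qed

lemma bij_betw_gt_of_tableau:
  assumes "q \<le> p" "antimono p" "antimono q"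
  shows "bij_betw (gt_of_tableau p q) (ssyt n p q) (gt_patterns n p q)"
proof (rule bij_betw_byWitness[where f' = "tableau_of_gt p q"])
  have qp: "q i \<le> p i" for i using assms(1) by (simp add: le_fun_def)
  show "\<forall>T\<in>ssyt n p q. tableau_of_gt p q (gt_of_tableau p q T) = T"
  proof
    fix T assume T: "T \<in> ssyt n p q"
    show "tableau_of_gt p q (gt_of_tableau p q T) = T"
    proof
      fix b :: "nat \<times> nat"
      obtain i j where b: "b = (i, j)" by (cases b)
      show "tableau_of_gt p q (gt_of_tableau p q T) b = T b"
      proof (cases "q i < j \<and> j \<le> p i")
        case True
        then have "(LEAST k. j \<le> gt_of_tableau p q T k i) = (LEAST k. T (i, j) \<le> k)"
          using le_gt_of_tableau_iff[OF T] by simp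
        also have "\<dots> = T (i, j)" by (rule Least_equality) auto
        finally show ?thesis using True b by (simp add: tableau_of_gt_def)
      next
        case False
        have "T \<in> extensional (skew_diagram p q)" using T by (auto simp: ssyt_def PiE_def)
        then show ?thesis using False b by (auto simp: tableau_of_gt_def extensional_def)
      qed
    qed
  qed
  show "\<forall>P\<in>gt_patterns n p q. gt_of_tableau p q (tableau_of_gt p q P) = P"
  proof (intro ballI ext)
    fix P k i assume P: "P \<in> gt_patterns n p q"
    show "gt_of_tableau p q (tableau_of_gt p q P) k i = P k i"
    proof (rule nat_eqI_le_iff[of "q i" _ "p i"])
      fix j assume "q i < j" "j \<le> p i"
      then show "j \<le> gt_of_tableau p q (tableau_of_gt p q P) k i \<longleftrightarrow> j \<le> P k i"
        using le_gt_of_tableau_iff[OF tableau_of_gt_in_ssyt[OF P assms(3)]] tableau_of_gt_le_iff[OF P]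
        by simp
    qed (use gt_of_tableau_bounds[of q i p] qp gt_lower[OF P] gt_upper[OF P] in auto)
  qed
  show "gt_of_tableau p q ` ssyt n p q \<subseteq> gt_patterns n p q"
    using gt_of_tableau_in_gt assms by blast
  show "tableau_of_gt p q ` gt_patterns n p q \<subseteq> ssyt n p q"
    using tableau_of_gt_in_ssyt assms by blast
qed

lemma gt_monomial_gt_of_tableau:
  assumes T: "T \<in> ssyt n p q" and "q \<le> p" "antimono p" "antimono q" and zero: "\<And>i. n \<le> i \<Longrightarrow> p i = 0"
  shows "gt_monomial n (gt_of_tableau p q T) = x_power n (weight p q T)"
proof -
  let ?P = "gt_of_tableau p q T"
  have qp: "q i \<le> p i" for i using assms(2) by (simp add: le_fun_def)
  note bounds = gt_of_tableau_bounds[where p = p and q = q and T = T, OF qp]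
  have "weight p q T k = (\<Sum>i<n. ?P k i - ?P (k - 1) i)" if "1 \<le> k" for k
  proof -
    have "{b \<in> skew_diagram p q. T b = k} = (SIGMA i:{..<n}. {?P (k - 1) i<..?P k i})"
    proof (rule set_eqI)
      fix b :: "nat \<times> nat"
      obtain i j where b: "b = (i, j)" by (cases b)
      show "b \<in> {b \<in> skew_diagram p q. T b = k} \<longleftrightarrow> b \<in> (SIGMA i:{..<n}. {?P (k - 1) i<..?P k i})"
      proof (cases "q i < j \<and> j \<le> p i")
        case True
        then have "i < n" using zero[of i] by (cases "i < n") auto
        moreover have "j \<le> ?P k i \<longleftrightarrow> T (i, j) \<le> k" "j \<le> ?P (k - 1) i \<longleftrightarrow> T (i, j) \<le> k - 1"
          using True le_gt_of_tableau_iff[OF T] by auto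
        ultimately show ?thesis using True b that by auto
      next
        case False
        then show ?thesis using b bounds(1)[of i "k - 1"] bounds(2)[of k i] by auto
      qed
    qed
    then show ?thesis by (simp add: weight_def)
  qed
  then show ?thesis unfolding gt_monomial_def x_power_def by (intro prod.cong) auto
qed

lemma skew_schur_eq_gt_sum:
  assumes "q \<le> p" "antimono p" "antimono q" "\<And>i. n \<le> i \<Longrightarrow> p i = 0"
  shows "skew_schur n p q = (\<Sum>P\<in>gt_patterns n p q. gt_monomial n P)"
  unfolding skew_schur_def
  by (subst sum.reindex_bij_betw[OF bij_betw_gt_of_tableau[OF assms(1-3)], symmetric])
    (use gt_monomial_gt_of_tableau assms in \<open>auto intro!: sum.cong\<close>)

lemma finite_gt_patterns:
  assumes "q \<le> p" "antimono p" "antimono q" "\<And>i. n \<le> i \<Longrightarrow> p i = 0"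
  shows "finite (gt_patterns n p q)"
proof -
  have "skew_diagram p q \<subseteq> {..<n} \<times> {..p 0}"
  proof
    fix b assume "b \<in> skew_diagram p q"
    then obtain i j where b: "b = (i, j)" "q i < j" "j \<le> p i" by (cases b) auto
    have "i < n" using assms(4)[of i] b by (cases "i < n") auto
    moreover have "p i \<le> p 0" using antimonoD[OF assms(2), of 0 i] by simp
    ultimately show "b \<in> {..<n} \<times> {..p 0}" using b by auto
  qed
  then have "finite (skew_diagram p q)" by (rule finite_subset) auto
  then have "finite (skew_diagram p q \<rightarrow>\<^sub>E {1..n})" by (rule finite_PiE) simp
  moreover have "ssyt n p q \<subseteq> skew_diagram p q \<rightarrow>\<^sub>E {1..n}" by (auto simp only: ssyt_def)
  ultimately have "finite (ssyt n p q)" by (rule rev_finite_subset)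
  then show ?thesis using bij_betw_finite[OF bij_betw_gt_of_tableau[OF assms(1-3)]] by blast
qed

lemma char_poly_eq_gt_prod:
  assumes "q \<le> p" "antimono p" "antimono q" "\<And>i. n \<le> i \<Longrightarrow> p i = 0"
  shows "(\<Prod>T\<in>ssyt n p q. [:- x_power n (weight p q T), 1:]) =
    (\<Prod>P\<in>gt_patterns n p q. [:- gt_monomial n P, 1:])"
  by (subst prod.reindex_bij_betw[OF bij_betw_gt_of_tableau[OF assms(1-3)], symmetric])
    (use gt_monomial_gt_of_tableau assms in \<open>auto intro!: prod.cong\<close>)

section \<open>Splitting one pattern off a stretched pattern\<close>

text \<open>
  A McShane extension: a monotone \<open>f\<close> of Lipschitz constant 1 with prescribed values exists as soon as
  the values to be interpolated satisfy the Lipschitz condition themselves.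
\<close>

lemma exists_lipschitz_interpolation:
  fixes X :: "(nat \<times> nat) set"
  assumes "finite X" "(0, 0) \<in> X"
    and lip: "\<And>q v q' v'. (q, v) \<in> X \<Longrightarrow> (q', v') \<in> X \<Longrightarrow> v' - v \<le> q' - q"
  obtains f :: "nat \<Rightarrow> nat" where "mono f" "mono (\<lambda>t. t - f t)" "\<And>t. f t \<le> t" "\<And>q v. (q, v) \<in> X \<Longrightarrow> f q = v"
proof -
  \<comment> \<open>the largest lower bound that the points of \<open>X\<close> force at \<open>t\<close>; the truncated outer difference costs nothing as \<open>f\<close> is nonnegative\<close>
  define f where "f t = Max ((\<lambda>(q, v). v - (q - t)) ` X)" for t
  have ge: "v - (q - t) \<le> f t" if "(q, v) \<in> X" for q v t
    unfolding f_def using assms(1) that by (intro Max_ge) force+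
  have attained: "\<exists>q v. (q, v) \<in> X \<and> f t = v - (q - t)" for t
  proof -
    have "f t \<in> (\<lambda>(q, v). v - (q - t)) ` X"
      unfolding f_def using assms(1,2) by (intro Max_in) auto
    then show ?thesis by auto
  qed
  have mono_f: "f t \<le> f t'" if "t \<le> t'" for t t'
  proof -
    obtain q v where "(q, v) \<in> X" "f t = v - (q - t)" using attained by blast
    then show ?thesis using ge[of q v t'] that by linarith
  qed
  have lip_f: "f t' \<le> f t + (t' - t)" if "t \<le> t'" for t t'
  proof -
    obtain q v where "(q, v) \<in> X" "f t' = v - (q - t')" using attained by blast
    then show ?thesis using ge[of q v t] that by linarith
  qed
  have le: "f t \<le> t" for t
  proof -
    obtain q v where "(q, v) \<in> X" "f t = v - (q - t)" using attained by blast
    moreover from this have "v \<le> q" using lip[of 0 0 q v] assms(2) by simp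
    ultimately show ?thesis by linarith
  qed
  have interp: "f q = v" if X: "(q, v) \<in> X" for q v
  proof (rule antisym)
    show "v \<le> f q" using ge[OF X, of q] by simp
    obtain q' v' where "(q', v') \<in> X" "f q = v' - (q' - q)" using attained by blast
    then show "f q \<le> v" using lip[OF X, of q' v'] by linarith
  qed
  show ?thesis
  proof (rule that)
    show "mono f" using mono_f by (simp add: mono_def)
    show "mono (\<lambda>t. t - f t)"
    proof (rule monoI)
      fix t t' :: nat assume "t \<le> t'"
      then show "t - f t \<le> t' - f t'" using lip_f[of t t'] le[of t] le[of t'] by linarith
    qed
  qed (use le interp in auto)
qed

text \<open>
  Applying one function \<open>f\<close> to all entries of \<open>P\<close> gives a pattern of shape \<open>\<mu>\<close> over \<open>\<nu>\<close> if \<open>f\<close> is monotone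
  and takes the boundary values \<open>c + (k + 1) * v\<close> to \<open>v\<close>; what remains is a pattern if \<open>t - f t\<close> is
  monotone too. Such an \<open>f\<close> exists once \<open>k\<close> is so large that the offsets \<open>c\<close> cannot upset the order
  and the spacing of the boundary values.
\<close>

lemma gt_pattern_split_step:
  assumes P: "P \<in> gt_patterns n (\<lambda>i. \<kappa> i + Suc k * \<mu> i) (\<lambda>i. lam i + Suc k * \<nu> i)"
    and small: "\<And>i. \<kappa> i \<le> k" "\<And>i. lam i \<le> k"
    and zero: "\<And>i. n \<le> i \<Longrightarrow> \<kappa> i = 0 \<and> \<mu> i = 0 \<and> lam i = 0 \<and> \<nu> i = 0"
  shows "\<exists>A\<in>gt_patterns n \<mu> \<nu>. \<exists>Q\<in>gt_patterns n (\<lambda>i. \<kappa> i + k * \<mu> i) (\<lambda>i. lam i + k * \<nu> i). P = Q + A"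
proof -
  \<comment> \<open>rows up to and including \<open>n\<close>, so that the pair \<open>(0, 0)\<close> of an empty row is present\<close>
  define X where "X = (\<lambda>i. (\<kappa> i + Suc k * \<mu> i, \<mu> i)) ` {..n} \<union> (\<lambda>i. (lam i + Suc k * \<nu> i, \<nu> i)) ` {..n}"
  have lip: "v' - v \<le> (c' + Suc k * v') - (c + Suc k * v)" if "c \<le> k" for c c' v v' :: nat
  proof (cases "v' \<le> v")
    case False
    then obtain d where d: "v' = v + Suc d" by (metis add_Suc_right less_imp_Suc_add not_le)
    then show ?thesis using that by (simp add: algebra_simps)
  qed simp
  have finX: "finite X" by (simp add: X_def)
  have zeroX: "(0, 0) \<in> X" using zero[of n] by (force simp: X_def)
  have lipX: "v' - v \<le> q' - q" if "(q, v) \<in> X" "(q', v') \<in> X" for q v q' v'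
  proof -
    have "\<exists>c\<le>k. q = c + Suc k * v" if "(q, v) \<in> X" for q v
      using that unfolding X_def
    proof
      assume "(q, v) \<in> (\<lambda>i. (\<kappa> i + Suc k * \<mu> i, \<mu> i)) ` {..n}"
      then show ?thesis using small(1) by (auto simp del: mult_Suc)
    next
      assume "(q, v) \<in> (\<lambda>i. (lam i + Suc k * \<nu> i, \<nu> i)) ` {..n}"
      then show ?thesis using small(2) by (auto simp del: mult_Suc)
    qed
    then show ?thesis using that lip by metis
  qed
  obtain f where f: "mono f" "mono (\<lambda>t. t - f t)" "\<And>t. f t \<le> t" "\<And>q v. (q, v) \<in> X \<Longrightarrow> f q = v"
    by (rule exists_lipschitz_interpolation[OF finX zeroX lipX]) (assumption | blast)+
  have f_outer: "f (\<kappa> i + Suc k * \<mu> i) = \<mu> i" for i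
  proof (cases "i \<le> n")
    case True
    then show ?thesis by (intro f(4)) (auto simp: X_def)
  next
    case False
    then show ?thesis using zero[of i] f(3)[of 0] by simp
  qed
  have f_inner: "f (lam i + Suc k * \<nu> i) = \<nu> i" for i
  proof (cases "i \<le> n")
    case True
    then show ?thesis by (intro f(4)) (auto simp: X_def)
  next
    case False
    then show ?thesis using zero[of i] f(3)[of 0] by simp
  qed
  define A where "A = (\<lambda>l i. f (P l i))"
  define Q where "Q = (\<lambda>l i. P l i - f (P l i))"
  have "A \<in> gt_patterns n \<mu> \<nu>"
    using gt_patterns_comp[OF P f(1)] unfolding A_def f_outer f_inner .
  moreover have "Q \<in> gt_patterns n (\<lambda>i. \<kappa> i + k * \<mu> i) (\<lambda>i. lam i + k * \<nu> i)"
    using gt_patterns_comp[OF P f(2)] unfolding Q_def f_outer f_inner by simp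
  moreover have "P = Q + A"
    using f(3) by (auto simp: A_def Q_def fun_eq_iff)
  ultimately show ?thesis by blast
qed

section \<open>Chains of patterns at unit distance\<close>

text \<open>
  The polytope of real patterns for a fixed shape has a triangulation into unimodular simplices
  whose vertex sets are chains of integer patterns within unit distance. Hence an integer pattern for
  the \<open>k\<close>-fold shape is the sum of exactly one multiset of size \<open>k\<close> supported on such a chain. The
  next two definitions describe these multisets.
\<close>

definition near :: "(nat \<Rightarrow> nat \<Rightarrow> nat) \<Rightarrow> (nat \<Rightarrow> nat \<Rightarrow> nat) \<Rightarrow> bool" where
  "near A B \<longleftrightarrow> (\<forall>k i. A k i \<le> B k i \<and> B k i \<le> Suc (A k i))"

definition close :: "(nat \<Rightarrow> nat \<Rightarrow> nat) multiset \<Rightarrow> bool" where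
  "close m \<longleftrightarrow> (\<forall>A\<in>#m. \<forall>B\<in>#m. near A B \<or> near B A)"

lemma near_refl [simp]: "near A A"
  by (simp add: near_def)

lemma near_antisym: "near A B \<Longrightarrow> near B A \<Longrightarrow> A = B"
  by (auto simp: near_def fun_eq_iff intro: antisym)

lemma close_has_least:
  assumes "close m" "m \<noteq> {#}"
  obtains A where "A \<in># m" "\<And>B. B \<in># m \<Longrightarrow> near A B"
proof -
  obtain A where A: "A \<in># m" "\<And>B. B \<in># m \<Longrightarrow> B \<le> A \<Longrightarrow> A = B"
    using finite_has_minimal[of "set_mset m"] assms(2) by auto
  have "near A B" if B: "B \<in># m" for B
  proof (cases "near A B")
    case False
    then have "near B A" using assms(1) A(1) B by (auto simp: close_def)
    then have "B \<le> A" by (auto simp: near_def le_fun_def)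
    then show ?thesis using A(2)[OF B] by simp
  qed
  then show ?thesis using that A(1) by blast
qed

lemma sum_mset_near_bounds:
  assumes "\<And>B. B \<in># m \<Longrightarrow> near A B"
  shows "size m * A k i \<le> (\<Sum>\<^sub># m) k i \<and> (\<Sum>\<^sub># m) k i \<le> size m * Suc (A k i)"
  using assms
proof (induction m)
  case (add B m)
  then have "A k i \<le> B k i" "B k i \<le> Suc (A k i)" by (auto simp: near_def)
  then show ?case using add by simp
qed simp

text \<open>
  All members exceed the least one \<open>A\<close> by 0 or 1 at each position, and \<open>A\<close> itself by 0, so dividing
  the sum by the number of summands leaves a proper remainder.
\<close>

lemma close_least_eq_div:
  assumes "A \<in># m" "\<And>B. B \<in># m \<Longrightarrow> near A B"
  shows "A k i = (\<Sum>\<^sub># m) k i div size m"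
proof -
  obtain m' where m': "m = add_mset A m'" using assms(1) by (metis insert_DiffM)
  have "size m' * A k i \<le> (\<Sum>\<^sub># m') k i \<and> (\<Sum>\<^sub># m') k i \<le> size m' * Suc (A k i)"
    using assms(2) m' by (intro sum_mset_near_bounds) auto
  then have "(\<Sum>\<^sub># m) k i div size m = A k i"
    by (intro div_nat_eqI) (auto simp: m')
  then show ?thesis by simp
qed

text \<open>
  The least member is determined by the sum and the size; remove it and continue.
\<close>

lemma close_eqI:
  assumes "close m" "close m'" "size m = size m'" "\<Sum>\<^sub># m = \<Sum>\<^sub># m'"
  shows "m = m'"
  using assms
proof (induction "size m" arbitrary: m m')
  case 0
  then show ?case by simp
next
  case (Suc s)
  then have "m \<noteq> {#}" "m' \<noteq> {#}" by auto
  then obtain A A' where A: "A \<in># m" "\<And>B. B \<in># m \<Longrightarrow> near A B" and A': "A' \<in># m'" "\<And>B. B \<in># m' \<Longrightarrow> near A' B"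
    using close_has_least Suc.prems(1,2) by metis
  have "A' = A"
    using close_least_eq_div[OF A] close_least_eq_div[OF A'] Suc.prems(3,4) by (simp add: fun_eq_iff)
  then obtain m1 m2 where m: "m = add_mset A m1" "m' = add_mset A m2"
    using A(1) A'(1) by (metis insert_DiffM)
  have "(\<Sum>\<^sub># m1) k i = (\<Sum>\<^sub># m2) k i" for k i
    using fun_cong[OF fun_cong[OF Suc.prems(4), of k], of i] m by simp
  then have "\<Sum>\<^sub># m1 = \<Sum>\<^sub># m2" by (simp add: fun_eq_iff)
  then have "m1 = m2"
    using Suc.hyps(1)[of m1 m2] Suc.hyps(2) Suc.prems m by (auto simp: close_def)
  then show ?case using m by simp
qed

text \<open>
  Split off the pointwise quotient by the number of summands, which is the only possible least
  member. The last conjunct, that each summand differs from the exact average by less than 1,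
  is there for the induction: it makes the later summands lie within unit distance above this quotient.
\<close>

lemma close_decomposition:
  assumes "P \<in> gt_patterns n (\<lambda>i. s * \<mu> i) (\<lambda>i. s * \<nu> i)"
  shows "\<exists>m. close m \<and> set_mset m \<subseteq> gt_patterns n \<mu> \<nu> \<and> size m = s \<and> \<Sum>\<^sub># m = P \<and>
    (\<forall>B\<in>#m. \<forall>k i. P k i < s * B k i + s \<and> s * B k i < P k i + s)"
  using assms
proof (induction s arbitrary: P)
  case 0
  have "P k i = 0" for k i using gt_upper[OF 0, of k i] by simp
  then have "P = 0" by (simp add: fun_eq_iff)
  then show ?case by (intro exI[of _ "{#}"]) (auto simp: close_def)
next
  case (Suc s)
  define A where "A = (\<lambda>k i. P k i div Suc s)"
  define Q where "Q = (\<lambda>k i. P k i - P k i div Suc s)"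
  have "mono (\<lambda>t. t div Suc s)" by (simp add: mono_def div_le_mono)
  from gt_patterns_comp[OF Suc.prems this] have A: "A \<in> gt_patterns n \<mu> \<nu>"
    unfolding A_def by (simp del: mult_Suc)
  have "mono (\<lambda>t. t - t div Suc s)"
  proof (rule mono_iff_le_Suc[THEN iffD2], rule allI)
    fix t :: nat
    have "Suc t div Suc s \<le> Suc (t div Suc s)" by (simp add: div_Suc)
    then show "t - t div Suc s \<le> Suc t - Suc t div Suc s" by simp
  qed
  from gt_patterns_comp[OF Suc.prems this] have "Q \<in> gt_patterns n (\<lambda>i. s * \<mu> i) (\<lambda>i. s * \<nu> i)"
    unfolding Q_def by (simp del: mult_Suc) simp
  from Suc.IH[OF this] obtain m where m: "close m" "set_mset m \<subseteq> gt_patterns n \<mu> \<nu>" "size m = s" "\<Sum>\<^sub># m = Q"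
    "\<And>B k i. B \<in># m \<Longrightarrow> Q k i < s * B k i + s \<and> s * B k i < Q k i + s"
    by blast
  have split: "\<exists>\<rho>. P k i = Suc s * A k i + \<rho> \<and> Q k i = s * A k i + \<rho> \<and> \<rho> \<le> s" for k i
  proof (intro exI[of _ "P k i mod Suc s"] conjI)
    show *: "P k i = Suc s * A k i + P k i mod Suc s" by (simp only: A_def mult_div_mod_eq)
    show "P k i mod Suc s \<le> s" using mod_less_divisor[of "Suc s" "P k i"] by simp
    have "Q k i = P k i - A k i" by (simp add: Q_def A_def)
    then show "Q k i = s * A k i + P k i mod Suc s" using * by simp
  qed
  have old: "A k i \<le> B k i \<and> B k i \<le> Suc (A k i) \<and> P k i < Suc s * B k i + Suc s \<and> Suc s * B k i < P k i + Suc s"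
    if B: "B \<in># m" for B k i
  proof -
    obtain \<rho> where \<rho>: "P k i = Suc s * A k i + \<rho>" "Q k i = s * A k i + \<rho>" "\<rho> \<le> s" using split by blast
    have b: "s * A k i + \<rho> < s * B k i + s" "s * B k i < s * A k i + \<rho> + s" using m(5)[OF B, of k i] \<rho> by auto
    have lo: "A k i \<le> B k i"
    proof (rule ccontr)
      assume "\<not> ?thesis"
      then have "s * Suc (B k i) \<le> s * A k i" by (intro mult_le_mono2) simp
      then show False using b by simp
    qed
    have hi: "B k i \<le> Suc (A k i)"
    proof (rule ccontr)
      assume "\<not> ?thesis"
      then have "s * Suc (Suc (A k i)) \<le> s * B k i" by (intro mult_le_mono2) simp
      then show False using b \<rho>(3) by simp
    qed
    have "B k i = A k i \<or> B k i = Suc (A k i)" using lo hi by linarith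
    then show ?thesis using lo hi b \<rho> by (auto simp: algebra_simps)
  qed
  have new: "P k i < Suc s * A k i + Suc s \<and> Suc s * A k i < P k i + Suc s" for k i
  proof -
    obtain \<rho> where "P k i = Suc s * A k i + \<rho>" "\<rho> \<le> s" using split by blast
    then show ?thesis by simp
  qed
  have "near A B" if "B \<in># m" for B using old[OF that] by (simp add: near_def)
  then have "close (add_mset A m)" using m(1) by (auto simp: close_def)
  moreover have "\<Sum>\<^sub># (add_mset A m) = P"
    using m(4) by (auto simp: fun_eq_iff A_def Q_def)
  ultimately show ?case
    using m(2,3) A old new by (intro exI[of _ "add_mset A m"]) auto
qed

lemma sum_mset_in_gt:
  assumes "set_mset m \<subseteq> gt_patterns n \<mu> \<nu>"
  shows "\<Sum>\<^sub># m \<in> gt_patterns n (\<lambda>i. size m * \<mu> i) (\<lambda>i. size m * \<nu> i) \<and>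
    gt_monomial n (\<Sum>\<^sub># m) = \<Prod>\<^sub># (image_mset (gt_monomial n) m)"
  using assms
proof (induction m)
  case empty
  then show ?case by (auto simp: gt_patterns_def gt_monomial_def x_power_def fun_eq_iff)
next
  case (add A m)
  then have A: "A \<in> gt_patterns n \<mu> \<nu>" and
    m: "\<Sum>\<^sub># m \<in> gt_patterns n (\<lambda>i. size m * \<mu> i) (\<lambda>i. size m * \<nu> i)"
      "gt_monomial n (\<Sum>\<^sub># m) = \<Prod>\<^sub># (image_mset (gt_monomial n) m)" by auto
  show ?case using gt_patterns_add[OF A m(1)] gt_monomial_add[OF A m(1)] m(2)
    by (simp only: sum_mset.add_mset image_mset_add_mset prod_mset.add_mset size_add_mset mult_Suc)
qed

lemma gt_sum_eq_close_sum:
  "(\<Sum>P\<in>gt_patterns n (\<lambda>i. s * \<mu> i) (\<lambda>i. s * \<nu> i). gt_monomial n P) =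
   (\<Sum>m | m \<in> {m. close m} \<and> set_mset m \<subseteq> gt_patterns n \<mu> \<nu> \<and> size m = s. \<Prod>\<^sub># (image_mset (gt_monomial n) m))"
proof -
  let ?D = "{m. m \<in> {m. close m} \<and> set_mset m \<subseteq> gt_patterns n \<mu> \<nu> \<and> size m = s}"
  have inj: "inj_on sum_mset ?D" by (auto simp: inj_on_def intro: close_eqI)
  have img: "gt_patterns n (\<lambda>i. s * \<mu> i) (\<lambda>i. s * \<nu> i) = sum_mset ` ?D"
  proof (intro equalityI subsetI)
    fix P assume "P \<in> gt_patterns n (\<lambda>i. s * \<mu> i) (\<lambda>i. s * \<nu> i)"
    from close_decomposition[OF this] show "P \<in> sum_mset ` ?D" by blast
  next
    fix P assume "P \<in> sum_mset ` ?D"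
    then show "P \<in> gt_patterns n (\<lambda>i. s * \<mu> i) (\<lambda>i. s * \<nu> i)" using sum_mset_in_gt by blast
  qed
  show ?thesis
    unfolding img sum.reindex[OF inj] comp_def using sum_mset_in_gt by (intro sum.cong) auto
qed

text \<open>
  One step upwards inside the set of patterns, cut off at its greatest element \<open>U\<close>.
\<close>

definition raise :: "(nat \<Rightarrow> nat \<Rightarrow> nat) \<Rightarrow> (nat \<Rightarrow> nat \<Rightarrow> nat) \<Rightarrow> nat \<Rightarrow> nat \<Rightarrow> nat" where
  "raise U A = (\<lambda>k i. min (U k i) (Suc (A k i)))"

lemma near_raise: "A \<le> U \<Longrightarrow> near A (raise U A)"
  by (auto simp: near_def raise_def le_fun_def)

lemma near_raise_right: "near A B \<Longrightarrow> B \<le> U \<Longrightarrow> near B (raise U A)"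
  unfolding near_def raise_def le_fun_def
  by (metis min.bounded_iff min.coboundedI2 not_less_eq_eq order_trans Suc_le_mono)

lemma raise_eq_self: "A \<le> U \<Longrightarrow> raise U A = A \<Longrightarrow> A = U"
proof (intro ext)
  fix k i assume "A \<le> U" "raise U A = A"
  then have "A k i \<le> U k i" "min (U k i) (Suc (A k i)) = A k i"
    by (auto simp: raise_def le_fun_def fun_eq_iff)
  then show "A k i = U k i" by (auto simp: min_def split: if_splits)
qed

text \<open>
  For a chain with least member \<open>A\<close>, the pattern \<open>raise U A\<close> lies above all members and is compatible
  with all of them, so it may be inserted or removed without destroying the chain or its least
  member. The empty chain has to be matched with the chain consisting of \<open>U\<close>, the only one whose
  least member is also the pattern to be moved.
\<close>

definition close_toggle :: "(nat \<Rightarrow> nat \<Rightarrow> nat) \<Rightarrow> (nat \<Rightarrow> nat \<Rightarrow> nat) multiset \<Rightarrow> nat \<Rightarrow> nat \<Rightarrow> nat" where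
  "close_toggle U m = (if m = {#} then U else raise U (THE A. A \<in># m \<and> (\<forall>B\<in>#m. near A B)))"

lemma close_toggle_eq:
  assumes "A \<in># m" "\<And>B. B \<in># m \<Longrightarrow> near A B"
  shows "close_toggle U m = raise U A"
proof -
  have "(THE A. A \<in># m \<and> (\<forall>B\<in>#m. near A B)) = A"
    using assms by (intro the_equality) (auto intro: near_antisym)
  then show ?thesis using assms(1) by (auto simp: close_toggle_def)
qed

text \<open>
  Closeness depends only on the underlying set, so pairs containing an element twice cancel with
  \<open>e = 1\<close>. The other pairs exist only for \<open>K = card L\<close>, and then they distribute the elements of \<open>L\<close>,
  each once, over \<open>S\<close> and \<open>m\<close>. Their sum is, up to a factor, the reduced Euler characteristic of the
  complex of chains at unit distance; toggling \<open>close_toggle U m\<close> shows that it vanishes. This is what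
  makes the recurrence start at 0.
\<close>

lemma close_multisets_recurrence:
  fixes z :: "(nat \<Rightarrow> nat \<Rightarrow> nat) \<Rightarrow> 'a::comm_ring_1"
  assumes fin: "finite L" and U: "U \<in> L" "\<And>A. A \<in> L \<Longrightarrow> A \<le> U"
    and raise: "\<And>A. A \<in> L \<Longrightarrow> raise U A \<in> L"
    and "card L \<le> K"
  shows "(\<Sum>S\<in>Pow L. (-1) ^ card S * prod z S *
    (\<Sum>m | m \<in> {m. close m} \<and> set_mset m \<subseteq> L \<and> size m = K - card S. \<Prod>\<^sub># (image_mset z m))) = 0"
proof -
  let ?M = "{m. close m}"
  have stable: "add_mset A m \<in> ?M \<longleftrightarrow> m \<in> ?M" if "set_mset m \<subseteq> L" "A \<in> L" "1 \<le> count m A" for m A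
  proof -
    have "A \<in># m" using that(3) by (simp add: count_greater_zero_iff[symmetric] del: count_greater_zero_iff)
    then have "set_mset (add_mset A m) = set_mset m" by auto
    then show ?thesis unfolding close_def mem_Collect_eq by simp
  qed
  show ?thesis
  proof (cases "card L = K")
    case False
    then show ?thesis
      using assms(5) by (intro stable_multisets_recurrence[where e = 1, OF fin stable]) auto
  next
    case True
    let ?X = "koszul_pairs L ?M K"
    let ?R = "{(S, m)\<in>?X. \<exists>A\<in>L. 1 < count (mset_set S + m) A}"
    define Y where "Y = {(S, m). S \<subseteq> L \<and> mset_set S + m = mset_set L \<and> close m}"
    \<comment> \<open>without repetitions, a multiset of size \<open>card L\<close> over \<open>L\<close> contains each element of \<open>L\<close> once\<close>
    have X: "?X = ?R \<union> Y"
    proof (intro equalityI subsetI)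
      fix x assume x: "x \<in> ?X"
      obtain S m where Sm: "x = (S, m)" by (cases x)
      show "x \<in> ?R \<union> Y"
      proof (cases "\<exists>A\<in>L. 1 < count (mset_set S + m) A")
        case True
        then show ?thesis using x Sm by auto
      next
        case nr: False
        have Sm': "S \<subseteq> L" "set_mset m \<subseteq> L" "card S + size m = K" "close m" "finite S"
          using x Sm fin by (auto simp: koszul_pairs_def intro: finite_subset)
        have "mset_set S + m \<subseteq># mset_set L"
        proof (rule mset_subset_eqI)
          fix A
          show "count (mset_set S + m) A \<le> count (mset_set L) A"
          proof (cases "A \<in> L")
            case True
            then show ?thesis using nr fin by (simp add: not_less)
          next
            case False
            then have "A \<notin> S" "A \<notin># m" using Sm' by auto
            then show ?thesis by (simp add: not_in_iff)
          qed
        qed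
        moreover have "size (mset_set S + m) = size (mset_set L)"
          using Sm'(3) True by simp
        ultimately have "mset_set S + m = mset_set L"
          by (metis mset_subset_size subset_mset.le_less less_irrefl)
        then show ?thesis using Sm Sm' by (simp add: Y_def)
      qed
    next
      fix x assume "x \<in> ?R \<union> Y"
      then show "x \<in> ?X"
      proof
        assume "x \<in> Y"
        then obtain S m where Sm: "x = (S, m)" "S \<subseteq> L" "mset_set S + m = mset_set L" "close m"
          by (auto simp: Y_def)
        have "size (mset_set S) + size m = size (mset_set L)" using Sm(3) by (metis size_union)
        then have "card S + size m = K" using True by simp
        moreover have "set_mset m \<subseteq> set_mset (mset_set L)" using Sm(3) by (metis set_mset_union Un_upper2)
        then have "set_mset m \<subseteq> L" using fin by simp
        ultimately show ?thesis using Sm by (auto simp: koszul_pairs_def)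
      qed auto
    qed
    have finX: "finite ?X" by (rule finite_koszul_pairs[OF fin])
    have disj: "?R \<inter> Y = {}"
    proof -
      have "count (mset_set L) A \<le> 1" for A using fin by (cases "A \<in> L") auto
      then have "\<not> 1 < count (mset_set S + m) A" if "(S, m) \<in> Y" for S m A
        using that unfolding Y_def by (simp add: not_less del: count_union)
      then show ?thesis by blast
    qed
    have Y_zero: "(\<Sum>(S, m)\<in>Y. (-1) ^ card S * prod z S * \<Prod>\<^sub># (image_mset z m)) = 0"
    proof (rule toggle_sum_zero[where \<iota> = "\<lambda>_. close_toggle U"])
      show "finite Y" by (rule finite_subset[OF _ finX]) (subst X, rule Un_upper2)
      show finS: "finite S" if "(S, m) \<in> Y" for S m
        using that fin by (auto simp: Y_def intro: finite_subset)
      fix S m assume Y: "(S, m) \<in> Y"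
      note finS = finS[OF Y]
      have SL: "S \<subseteq> L" and W: "mset_set S + m = mset_set L" and cl: "close m" using Y by (auto simp: Y_def)
      have mL: "B \<in> L" if "B \<in># m" for B
      proof -
        have "B \<in># mset_set S + m" using that by simp
        then show ?thesis unfolding W using fin by simp
      qed
      let ?i = "close_toggle U m"
      show "(S - {?i}, add_mset ?i m) \<in> Y \<and> close_toggle U (add_mset ?i m) = ?i" if iS: "?i \<in> S"
      proof -
        have W': "mset_set (S - {?i}) + add_mset ?i m = mset_set L"
          using W finS iS by (simp add: mset_set.remove)
        have "close (add_mset ?i m) \<and> close_toggle U (add_mset ?i m) = ?i"
        proof (cases "m = {#}")
          case True
          then have "?i = U" by (simp add: close_toggle_def)
          moreover have "close_toggle U {#U#} = raise U U" by (rule close_toggle_eq) auto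
          moreover have "raise U U = U" by (simp add: raise_def min_def)
          ultimately show ?thesis using True by (simp add: close_def)
        next
          case False
          then obtain A where A: "A \<in># m" "\<And>B. B \<in># m \<Longrightarrow> near A B"
            using close_has_least[OF cl] by blast
          have i: "?i = raise U A" by (rule close_toggle_eq[OF A])
          have "near B ?i" if "B \<in># m" for B
            unfolding i by (rule near_raise_right[OF A(2)[OF that] U(2)[OF mL[OF that]]])
          then have "close (add_mset ?i m)" using cl by (auto simp: close_def)
          moreover have "close_toggle U (add_mset ?i m) = raise U A"
            using A near_raise[OF U(2)[OF mL[OF A(1)]]] i by (intro close_toggle_eq) auto
          ultimately show ?thesis using i by simp
        qed
        then show ?thesis using W' SL by (auto simp: Y_def)
      qed
      show "?i \<in># m \<and> (insert ?i S, m - {#?i#}) \<in> Y \<and> close_toggle U (m - {#?i#}) = ?i" if iS: "?i \<notin> S"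
      proof -
        have m0: "m \<noteq> {#}"
        proof
          assume "m = {#}"
          then have "?i = U" "S = L" using W finS fin by (auto simp: close_toggle_def mset_set_eq_iff)
          then show False using iS U(1) by simp
        qed
        then obtain A where A: "A \<in># m" "\<And>B. B \<in># m \<Longrightarrow> near A B"
          using close_has_least[OF cl] by blast
        have i: "?i = raise U A" by (rule close_toggle_eq[OF A])
        have AU: "A \<le> U" using U(2) mL A(1) by blast
        have iL: "?i \<in> L" unfolding i using raise mL A(1) by blast
        have count1: "count m B \<le> 1" for B
        proof -
          have "count m B \<le> count (mset_set S + m) B" by simp
          also have "\<dots> \<le> 1" unfolding W using fin by (cases "B \<in> L") auto
          finally show ?thesis .
        qed
        have "count (mset_set S + m) ?i = 1" unfolding W using fin iL by simp
        then have im: "?i \<in># m" using iS by (metis count_mset_set(3) count_union add_0 not_in_iff zero_neq_one)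
        then obtain m' where m': "m = add_mset ?i m'" by (metis insert_DiffM)
        have "mset_set (insert ?i S) + m' = mset_set L"
          using W m' finS iS by (metis mset_set.insert union_mset_add_mset_left union_mset_add_mset_right)
        moreover have "close m'"
          using cl m' unfolding close_def by (metis add_mset_add_single union_iff)
        ultimately have "(insert ?i S, m') \<in> Y" using SL iL by (simp add: Y_def)
        moreover have "close_toggle U m' = ?i"
        proof (cases "A = ?i")
          case True
          then have AU': "A = U" using raise_eq_self[OF AU] i by simp
          have "B = A" if "B \<in># m" for B
            using A(2)[OF that] U(2)[OF mL[OF that]] AU'
            by (simp add: near_def le_fun_def fun_eq_iff antisym)
          moreover have "A \<notin># m'"
            using count1[of ?i] m' True by (metis One_nat_def add_le_same_cancel1 count_add_mset le_zero_eq not_in_iff plus_1_eq_Suc)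
          ultimately have "m' = {#}" using m' by (metis multiset_nonemptyE union_iff add_mset_add_single)
          then show ?thesis using True AU' by (simp add: close_toggle_def)
        next
          case False
          have "A \<in># add_mset ?i m'" by (rule subst[OF m', of "\<lambda>x. A \<in># x"]) (rule A(1))
          with False have "A \<in># m'" by simp
          moreover have "near A B" if "B \<in># m'" for B
            using A(2) m' that by (metis add_mset_add_single union_iff)
          ultimately show ?thesis using i close_toggle_eq by metis
        qed
        moreover have "m - {#?i#} = m'" using m' by (metis add_mset_remove_trivial)
        ultimately show ?thesis using im by simp
      qed
    qed
    have "(\<Sum>(S, m)\<in>?X. (-1) ^ card S * prod z S * \<Prod>\<^sub># (image_mset z m)) =
        (\<Sum>(S, m)\<in>?R. (-1) ^ card S * prod z S * \<Prod>\<^sub># (image_mset z m)) +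
        (\<Sum>(S, m)\<in>Y. (-1) ^ card S * prod z S * \<Prod>\<^sub># (image_mset z m))"
      using finX X disj by (metis (no_types, lifting) finite_Un sum.union_disjoint)
    also have "\<dots> = 0"
      unfolding Y_zero add_0_right
      by (rule koszul_sum_repeated[OF fin, where e = 1]) (rule stable)
    finally show ?thesis
      unfolding alternating_sum_eq_koszul_sum[OF fin assms(5)] .
  qed
qed

text \<open>
  Row \<open>k\<close> arises from \<open>q\<close> by \<open>k\<close> maximal horizontal strips inside \<open>p\<close>: each strip moves the
  interlacing bound down by one row, and the first \<open>k\<close> rows are bounded by \<open>p\<close> only.
\<close>

definition gt_top :: "(nat \<Rightarrow> nat) \<Rightarrow> (nat \<Rightarrow> nat) \<Rightarrow> nat \<Rightarrow> nat \<Rightarrow> nat" where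
  "gt_top p q k i = (if i < k then p i else min (p i) (q (i - k)))"

lemma gt_top_in_gt:
  assumes "q \<le> p" "antimono p" "antimono q" "\<And>i. n \<le> i \<Longrightarrow> p i = 0"
  shows "gt_top p q \<in> gt_patterns n p q"
proof -
  have "gt_top p q 0 = q" using assms(1) by (auto simp: gt_top_def le_fun_def fun_eq_iff min_def antisym)
  moreover have "gt_top p q k = p" if "n \<le> k" for k
    using that assms(4) by (auto simp: gt_top_def fun_eq_iff)
  moreover have "gt_top p q k i \<le> gt_top p q (Suc k) i" for k i
    using antimonoD[OF assms(3), of "i - Suc k" "i - k"] by (auto simp: gt_top_def intro: min.coboundedI2)
  moreover have "gt_top p q (Suc k) (Suc i) \<le> gt_top p q k i" for k i
    using antimonoD[OF assms(2), of i "Suc i"] by (auto simp: gt_top_def)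
  ultimately show ?thesis unfolding gt_patterns_def by blast
qed

lemma gt_top_greatest:
  assumes P: "P \<in> gt_patterns n p q"
  shows "P \<le> gt_top p q"
proof -
  have "P k i \<le> q (i - k)" if "k \<le> i" for k i
    using that
  proof (induction k arbitrary: i)
    case 0
    then show ?case using P by (simp add: gt_patterns_def)
  next
    case (Suc k)
    then obtain i0 where i0: "i = Suc i0" by (cases i) auto
    have "P (Suc k) i \<le> P k i0" using P i0 by (simp add: gt_patterns_def)
    also have "\<dots> \<le> q (i0 - k)" using Suc i0 by simp
    finally show ?case using i0 by simp
  qed
  then show ?thesis using gt_upper[OF P] by (auto simp: gt_top_def le_fun_def)
qed

lemma raise_in_gt:
  assumes "U \<in> gt_patterns n p q" "A \<in> gt_patterns n p q"
  shows "raise U A \<in> gt_patterns n p q"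
  using assms by (auto simp: gt_patterns_def raise_def fun_eq_iff min_le_iff_disj intro: min.coboundedI1 min.coboundedI2)

section \<open>Variables of the characteristic polynomial\<close>

lemma vars_of_add: "vars_of f \<subseteq> X \<Longrightarrow> vars_of g \<subseteq> X \<Longrightarrow> vars_of (f + g) \<subseteq> X"
  unfolding vars_of_def using keys_add[of f g] by blast

lemma vars_of_uminus: "vars_of (- f) = vars_of f"
  by (simp add: vars_of_def)

lemma vars_of_mult: "vars_of f \<subseteq> X \<Longrightarrow> vars_of g \<subseteq> X \<Longrightarrow> vars_of (f * g) \<subseteq> X"
proof
  fix x assume f: "vars_of f \<subseteq> X" and g: "vars_of g \<subseteq> X" and "x \<in> vars_of (f * g)"
  then obtain e where e: "e \<in> Poly_Mapping.keys (f * g)" "x \<in> Poly_Mapping.keys e"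
    by (auto simp: vars_of_def)
  then obtain a b where ab: "e = a + b" "a \<in> Poly_Mapping.keys f" "b \<in> Poly_Mapping.keys g"
    using keys_mult[of f g] by blast
  then have "x \<in> Poly_Mapping.keys a \<or> x \<in> Poly_Mapping.keys b" using e(2) keys_add[of a b] by blast
  then show "x \<in> X" using ab f g by (auto simp: vars_of_def)
qed

lemma vars_of_0 [simp]: "vars_of 0 = {}"
  by (simp add: vars_of_def)

lemma vars_of_1 [simp]: "vars_of 1 = {}"
  by (simp add: vars_of_def)

lemma vars_of_prod:
  assumes "\<And>i. i \<in> I \<Longrightarrow> vars_of (f i) \<subseteq> X"
  shows "vars_of (prod f I) \<subseteq> X"
  using assms by (induction I rule: infinite_finite_induct) (simp_all add: vars_of_mult)

lemma vars_of_x_power: "vars_of (x_power n a) \<subseteq> {1..n}"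
  unfolding x_power_def
proof (rule vars_of_prod)
  fix k assume k: "k \<in> {1..n}"
  have v: "vars_of (var k) \<subseteq> {1..n}" using k by (simp add: vars_of_def var_def)
  have "vars_of (var k ^ d) \<subseteq> {1..n}" for d
    by (induction d) (simp, simp only: power_Suc vars_of_mult v)
  then show "vars_of (var k ^ a k) \<subseteq> {1..n}" .
qed

lemma vars_of_coeff_prod_linear:
  assumes "\<And>i. i \<in> I \<Longrightarrow> vars_of (z i) \<subseteq> X"
  shows "vars_of (coeff (\<Prod>i\<in>I. [:- z i, 1:]) k) \<subseteq> X"
  using assms
proof (induction I arbitrary: k rule: infinite_finite_induct)
  case (insert x I)
  let ?p = "\<Prod>i\<in>I. [:- z i, 1:]"
  have p: "vars_of (coeff ?p k) \<subseteq> X" for k using insert by auto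
  have "coeff (\<Prod>i\<in>insert x I. [:- z i, 1:]) k = - z x * coeff ?p k + coeff (pCons 0 ?p) k"
    using insert.hyps by simp
  moreover have "vars_of (coeff (pCons 0 ?p) k) \<subseteq> X"
    using p by (simp add: coeff_pCons split: nat.split)
  moreover have "vars_of (- z x * coeff ?p k) \<subseteq> X"
    using insert.prems[of x] by (intro vars_of_mult p) (simp add: vars_of_uminus)
  ultimately show ?case by (simp only: vars_of_add)
qed (auto simp: coeff_1)

section \<open>Skew Schur polynomials of stretched shapes\<close>

theorem theorem1:
  fixes n :: nat
    and \<kappa> lam \<mu> \<nu> :: "nat \<Rightarrow> nat"
  assumes "n > 0"
    and "is_partition \<kappa>" "partition_length \<kappa> \<le> n"
    and "is_partition lam" "partition_length lam \<le> n"
    and "is_partition \<mu>" "partition_length \<mu> \<le> n"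
    and "is_partition \<nu>" "partition_length \<nu> \<le> n"
    and "\<nu> \<le> \<mu>"
    and "\<exists>m::nat. m > 0 \<and>
           (\<forall>i. int (lam i) - int (\<kappa> i) \<le> int m * (int (\<mu> i) - int (\<nu> i)))"
  shows
    "let outer = (\<lambda>k i. \<kappa> i + k * \<mu> i);
         inner = (\<lambda>k i. lam i + k * \<nu> i);
         \<chi> = (\<Prod>T \<in> ssyt n \<mu> \<nu>. [:- x_power n (weight \<mu> \<nu> T), 1:]);
         recurs_from = (\<lambda>r. (\<forall>k\<ge>r. inner k \<le> outer k) \<and>
           satisfies_linear_recurrence r (\<lambda>k. skew_schur n (outer k) (inner k)) \<chi>)
     in (\<forall>i. vars_of (coeff \<chi> i) \<subseteq> {1..n}) \<and>
        (\<exists>r0. \<forall>r\<ge>r0. recurs_from r) \<and>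
        (lam = empty_partition \<and> \<kappa> = empty_partition \<longrightarrow> recurs_from 0)"
proof -
  define outer where "outer = (\<lambda>k i. \<kappa> i + k * \<mu> i)"
  define inner where "inner = (\<lambda>k i. lam i + k * \<nu> i)"
  define \<chi> where "\<chi> = (\<Prod>T \<in> ssyt n \<mu> \<nu>. [:- x_power n (weight \<mu> \<nu> T), 1:])"
  define a where "a = (\<lambda>k. skew_schur n (outer k) (inner k))"
  let ?L = "gt_patterns n \<mu> \<nu>"
  let ?z = "gt_monomial n"
  have anti: "antimono \<kappa>" "antimono lam" "antimono \<mu>" "antimono \<nu>"
    using assms(2,4,6,8) by (auto simp: is_partition_def)
  have zero: "\<kappa> i = 0 \<and> \<mu> i = 0 \<and> lam i = 0 \<and> \<nu> i = 0" if "n \<le> i" for i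
    using partition_zero_beyond_length that assms(2-9) by metis
  have anti_lin: "antimono (\<lambda>i. p i + k * p' i)" if "antimono p" "antimono p'" for p p' :: "nat \<Rightarrow> nat" and k
    using that unfolding antimono_def by (simp add: add_mono)
  have anti': "antimono (outer k)" "antimono (inner k)" for k
    unfolding outer_def inner_def using anti by (intro anti_lin; simp)+
  have zero': "outer k i = 0" if "n \<le> i" for k i using zero[OF that] by (simp add: outer_def)
  have finL: "finite ?L" using finite_gt_patterns[OF assms(10) anti(3,4)] zero by blast
  have \<chi>: "\<chi> = (\<Prod>P\<in>?L. [:- ?z P, 1:])"
    unfolding \<chi>_def using char_poly_eq_gt_prod[OF assms(10) anti(3,4)] zero by blast
  have vars: "vars_of (coeff \<chi> i) \<subseteq> {1..n}" for i
    unfolding \<chi>_def by (rule vars_of_coeff_prod_linear) (rule vars_of_x_power)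
  obtain m where m: "\<And>i. int (lam i) - int (\<kappa> i) \<le> int m * (int (\<mu> i) - int (\<nu> i))"
    using assms(11) by blast
  have contained: "inner k \<le> outer k" if "m \<le> k" for k
  proof (rule le_funI)
    fix i
    have "int m * (int (\<mu> i) - int (\<nu> i)) \<le> int k * (int (\<mu> i) - int (\<nu> i))"
      using that assms(10) by (intro mult_right_mono) (auto simp: le_fun_def)
    then have "int (lam i) + int k * int (\<nu> i) \<le> int (\<kappa> i) + int k * int (\<mu> i)"
      using m[of i] by (simp add: right_diff_distrib)
    then have "int (lam i + k * \<nu> i) \<le> int (\<kappa> i + k * \<mu> i)" by simp
    then show "inner k i \<le> outer k i" unfolding outer_def inner_def by (simp only: of_nat_le_iff)
  qed
  define G where "G k = gt_patterns n (outer k) (inner k)" for k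
  have a_eq: "a k = (\<Sum>P\<in>G k. ?z P)" if "inner k \<le> outer k" for k
    unfolding a_def G_def using skew_schur_eq_gt_sum[OF that anti'] zero' by blast
  have eventually: "\<exists>r0. \<forall>r\<ge>r0. (\<forall>k\<ge>r. inner k \<le> outer k) \<and> satisfies_linear_recurrence r a \<chi>"
  proof -
    \<comment> \<open>from here on the shapes are nested and \<open>k\<close> is at least every part of \<open>\<kappa>\<close> and \<open>lam\<close>\<close>
    define r where "r = m + \<kappa> 0 + lam 0"
    have small: "\<kappa> i \<le> r" "lam i \<le> r" for i
      using antimonoD[OF anti(1), of 0 i] antimonoD[OF anti(2), of 0 i] by (auto simp: r_def)
    obtain \<alpha> where \<alpha>: "bij_betw \<alpha> {0..<card ?L} ?L"
      using ex_bij_betw_nat_finite[OF finL] by blast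
    let ?I = "{0..<card ?L}"
    have \<alpha>_in: "\<alpha> i \<in> ?L" if "i \<in> ?I" for i using \<alpha> that by (auto simp: bij_betw_def)
    have "\<exists>r0. \<forall>k\<ge>r0. (\<Sum>S\<in>Pow ?I. (-1) ^ card S * (\<Prod>i\<in>S. ?z (\<alpha> i)) *
        (\<Sum>Q\<in>G (k + card ?I - card S). ?z Q)) = 0"
    proof (rule finitely_generated_recurrence[where r = r])
      show "finite (G r)"
        unfolding G_def using contained[of r] anti' zero' by (intro finite_gt_patterns) (auto simp: r_def)
      fix k Q assume k: "r \<le> k"
      show "Q + \<alpha> i \<in> G (Suc k)" if "Q \<in> G k" "i \<in> ?I" for i
        using gt_patterns_add[OF that(1)[unfolded G_def] \<alpha>_in[OF that(2)]]
        by (simp add: G_def outer_def inner_def add_ac)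
      show "?z (Q + \<alpha> i) = ?z Q * ?z (\<alpha> i)" if "Q \<in> G k" "i \<in> ?I" for i
        by (rule gt_monomial_add[OF that(1)[unfolded G_def] \<alpha>_in[OF that(2)]])
      show "\<exists>i\<in>?I. \<exists>P\<in>G k. Q = P + \<alpha> i" if "Q \<in> G (Suc k)"
      proof -
        have "\<exists>A\<in>?L. \<exists>P\<in>G k. Q = P + A"
          unfolding G_def outer_def inner_def
          using that small k zero unfolding G_def outer_def inner_def
          by (intro gt_pattern_split_step) (auto intro: order_trans)
        then obtain A P where A: "A \<in> ?L" "P \<in> G k" "Q = P + A" by blast
        obtain i where "i \<in> ?I" "A = \<alpha> i" using \<alpha> A(1) by (metis bij_betw_imp_surj_on imageE)
        then show ?thesis using A by blast
      qed
    qed simp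
    then obtain r1 where r1: "\<And>k. r1 \<le> k \<Longrightarrow> (\<Sum>S\<in>Pow ?I. (-1) ^ card S * (\<Prod>i\<in>S. ?z (\<alpha> i)) *
        (\<Sum>Q\<in>G (k + card ?I - card S). ?z Q)) = 0"
      by blast
    have \<chi>': "\<chi> = (\<Prod>i\<in>?I. [:- ?z (\<alpha> i), 1:])"
      unfolding \<chi> using prod.reindex_bij_betw[OF \<alpha>, of "\<lambda>P. [:- ?z P, 1:]"] by simp
    have "satisfies_linear_recurrence s a \<chi>" if s: "r1 + r \<le> s" for s
      unfolding \<chi>'
    proof (subst satisfies_linear_recurrence_prod_iff, simp, intro allI impI)
      fix k assume "s \<le> k"
      then have k: "r1 \<le> k" "r \<le> k" using s by auto
      have "a (k + card ?I - card S) = (\<Sum>Q\<in>G (k + card ?I - card S). ?z Q)" if "S \<in> Pow ?I" for S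
      proof -
        have "card S \<le> card ?I" using that by (intro card_mono) auto
        then show ?thesis using k by (intro a_eq contained) (simp add: r_def)
      qed
      then show "(\<Sum>S\<in>Pow ?I. (-1) ^ card S * (\<Prod>i\<in>S. ?z (\<alpha> i)) * a (k + card ?I - card S)) = 0"
        using r1[OF k(1)] by simp
    qed
    moreover have "inner k \<le> outer k" if "r1 + r \<le> k" for k
      using that by (intro contained) (simp add: r_def)
    ultimately show ?thesis by (intro exI[of _ "r1 + r"]) auto
  qed
  have from_0: "(\<forall>k\<ge>0. inner k \<le> outer k) \<and> satisfies_linear_recurrence 0 a \<chi>"
    if empty: "lam = empty_partition" "\<kappa> = empty_partition"
  proof
    have shapes: "outer = (\<lambda>k i. k * \<mu> i)" "inner = (\<lambda>k i. k * \<nu> i)"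
      using empty by (auto simp: outer_def inner_def empty_partition_def)
    show le: "\<forall>k\<ge>0. inner k \<le> outer k" using assms(10) by (simp add: shapes le_fun_def)
    let ?U = "gt_top \<mu> \<nu>"
    have U: "?U \<in> ?L" using gt_top_in_gt[OF assms(10) anti(3,4)] zero by blast
    have a_close: "a s = (\<Sum>m | m \<in> {m. close m} \<and> set_mset m \<subseteq> ?L \<and> size m = s. \<Prod>\<^sub># (image_mset ?z m))" for s
      using le a_eq[of s] gt_sum_eq_close_sum[of n s \<mu> \<nu>] by (simp add: G_def shapes)
    show "satisfies_linear_recurrence 0 a \<chi>"
      unfolding \<chi> satisfies_linear_recurrence_prod_iff[OF finL] a_close
    proof (intro allI impI close_multisets_recurrence[OF finL U])
      show "A \<le> ?U" "raise ?U A \<in> ?L" if "A \<in> ?L" for A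
        using gt_top_greatest[OF that] raise_in_gt[OF U that] by auto
    qed simp
  qed
  show ?thesis
    unfolding Let_def
    using vars eventually from_0 unfolding a_def outer_def inner_def \<chi>_def by blast
qed

end
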